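(* Let $R=K[X_1,\dots,X_n]$ be a standard graded polynomial ring over a field $K$, let $\mathcal X\subseteq\mathbb N$ be a set of indices, let $m\in\mathbb Z$, and let $$\mathbf C:\quad 0\to C_n\to C_{n-1}\to\cdots\to C_0\to 0$$ be a complex of finitely generated graded $R$-modules. Denote by $Z_i$, $B_i$ and $H_i(\mathbf C)=Z_i/B_i$ its cycles, boundaries and homology at $C_i$. First part. Suppose that $C_i$ is $(m+i)$-$\operatorname{reg}^{\mathcal X+i}$ for all $i>0$ and that $H_i(\mathbf C)$ is $(m+i+1)$-$\operatorname{reg}^{\mathcal X+i+1}$ for all $i>0$. Then: (1) $B_i$ is $(m+i+1)$-$\operatorname{reg}^{\mathcal X+i+1}$ for all $i\ge 0$. (2) If $C_0$ is $m$-$\operatorname{reg}^{\mathcal X}$, then so is $H_0(\mathbf C)$. Second part. Suppose that $C_{n-i}$ is $(m-i)$-$\operatorname{reg}^{\mathcal X-i}$ for all $i\ge 0$ and that $H_{n-i}(\mathbf C)$ is $(m-i-1)$-$\operatorname{reg}^{\mathcal X-i-1}$ for all $i>0$. Then: (1$'$) $Z_{n-i}$ is $(m-i)$-$\operatorname{reg}^{\mathcal X-i}$ for all $i\ge 0$. (2$'$) In particular, $H_n(\mathbf C)$ is $m$-$\operatorname{reg}^{\mathcal X}$.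
   Context: $R_+$ is the homogeneous maximal ideal of $R$. For a graded $R$-module $M=\bigoplus_{i\in\mathbb Z}M_i$ and $a\in\mathbb Z$, $M_{>a}=\bigoplus_{i>a}M_i$. $H^i_{R_+}(M)$ is the (graded) $i$-th local cohomology module. For $\mathcal X\subseteq\mathbb N$ (with $0\in\mathbb N$) and a finitely generated graded $R$-module $M$, $M$ is $m$-regular with respect to $\mathcal X$, written "$M$ is $m$-$\operatorname{reg}^{\mathcal X}$", if $H^i_{R_+}(M)_{>m-i}=0$ for all $i\in\mathcal X$. For $a\in\mathbb Z$, $\mathcal X+a:=\{i+a\mid i\in\mathcal X\}\cap\mathbb N$. Maps between graded modules are homogeneous of degree $0$. Modules $C_j$ with $j\notin\{0,\dots,n\}$ are zero; $Z_i=\ker(C_i\to C_{i-1})$ and $B_i=\operatorname{im}(C_{i+1}\to C_i)$. *)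

theory Defs
  imports
    "HOL-Library.Poly_Mapping"
    "HOL-Library.FuncSet"
    "HOL-Algebra.Module"
    "HOL-Algebra.AbelCoset"
    "HOL-Algebra.Generated_Groups"
begin

section \<open>The standard graded polynomial ring\<close>

text \<open>
  The variables are indexed by \<open>{0, \<dots>, n - 1}\<close>; monomials are exponent vectors
  \<open>nat \<Rightarrow>\<^sub>0 nat\<close>, and polynomials are finitely supported functions from monomials to \<open>K\<close>
  with the convolution product.
\<close>

type_synonym 'k mpoly = "(nat \<Rightarrow>\<^sub>0 nat) \<Rightarrow>\<^sub>0 'k"

definition mpoly_ring :: "nat \<Rightarrow> 'k::field mpoly ring" where
  "mpoly_ring n =
     \<lparr>carrier = {p. \<forall>t\<in>Poly_Mapping.keys p. Poly_Mapping.keys t \<subseteq> {..<n}},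
      mult = (*), one = 1, zero = 0, add = (+)\<rparr>"

definition monom_degree :: "(nat \<Rightarrow>\<^sub>0 nat) \<Rightarrow> nat" where
  "monom_degree t = (\<Sum>i\<in>Poly_Mapping.keys t. Poly_Mapping.lookup t i)"

definition monom :: "(nat \<Rightarrow>\<^sub>0 nat) \<Rightarrow> 'k::field mpoly" where
  "monom t = Poly_Mapping.single t 1"

definition homogeneous :: "nat \<Rightarrow> int \<Rightarrow> 'k::field mpoly set" where
  "homogeneous n d =
     {p \<in> carrier (mpoly_ring n). \<forall>t\<in>Poly_Mapping.keys p. int (monom_degree t) = d}"


section \<open>Graded modules\<close>

text \<open>
  The fields \<open>mult\<close> and \<open>one\<close>, which the record of modules inherits from the record of rings,
  play no role in the theory of modules; they are left unspecified below.
\<close>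

record ('a, 'b) graded_module = "('a, 'b) module" +
  grade :: "int \<Rightarrow> 'b set"

locale graded_mpoly_module = module "mpoly_ring n" M
  for n :: nat and M :: "('k::field mpoly, 'b) graded_module" (structure) +
  assumes grade_subgroup: "subgroup (grade M d) (add_monoid M)"
    and grade_decomposition: "x \<in> carrier M \<Longrightarrow>
      \<exists>!f. (\<forall>d. f d \<in> grade M d) \<and> finite {d. f d \<noteq> \<zero>} \<and> x = (\<Oplus>d\<in>{d. f d \<noteq> \<zero>}. f d)"
    and grade_smult: "p \<in> homogeneous n d \<Longrightarrow> x \<in> grade M e \<Longrightarrow> p \<odot> x \<in> grade M (d + e)"

definition fin_gen :: "nat \<Rightarrow> ('k::field mpoly, 'b) graded_module \<Rightarrow> bool" where
  "fin_gen n M \<longleftrightarrow>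
     (\<exists>S. finite S \<and> S \<subseteq> carrier M \<and>
          (\<forall>N. submodule N (mpoly_ring n) M \<and> S \<subseteq> N \<longrightarrow> N = carrier M))"

definition graded_hom ::
  "nat \<Rightarrow> ('k::field mpoly, 'b) graded_module \<Rightarrow> ('k mpoly, 'c) graded_module \<Rightarrow> ('b \<Rightarrow> 'c) set"
  where
  "graded_hom n M N =
     {f \<in> carrier M \<rightarrow> carrier N.
        (\<forall>x\<in>carrier M. \<forall>y\<in>carrier M. f (x \<oplus>\<^bsub>M\<^esub> y) = f x \<oplus>\<^bsub>N\<^esub> f y) \<and>
        (\<forall>r\<in>carrier (mpoly_ring n). \<forall>x\<in>carrier M. f (r \<odot>\<^bsub>M\<^esub> x) = r \<odot>\<^bsub>N\<^esub> f x) \<and>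
        (\<forall>d. \<forall>x\<in>grade M d. f x \<in> grade N d)}"

text \<open>
  For a homogeneous submodule \<open>N\<close> of \<open>M\<close>: \<open>submod M N\<close> is \<open>N\<close> as a graded module, and
  \<open>quot M N\<close> is the graded module \<open>M / N\<close>, whose elements are the cosets of \<open>N\<close>.
\<close>

definition submod :: "('a, 'b) graded_module \<Rightarrow> 'b set \<Rightarrow> ('a, 'b) graded_module" where
  "submod M N = M\<lparr>carrier := N, grade := \<lambda>d. grade M d \<inter> N\<rparr>"

definition quot :: "('a, 'b) graded_module \<Rightarrow> 'b set \<Rightarrow> ('a, 'b set) graded_module" where
  "quot M N =
     \<lparr>carrier = a_rcosets\<^bsub>M\<^esub> N, mult = undefined, one = undefined,
      zero = N, add = (\<lambda>A B. A <+>\<^bsub>M\<^esub> B),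
      smult = (\<lambda>r A. \<Union>x\<in>A. N +>\<^bsub>M\<^esub> (r \<odot>\<^bsub>M\<^esub> x)),
      grade = (\<lambda>d. (\<lambda>x. N +>\<^bsub>M\<^esub> x) ` grade M d)\<rparr>"

text \<open>\<open>grade_above M a\<close> is $M_{>a} = \bigoplus_{i > a} M_i$, an internal direct sum.\<close>

definition grade_above :: "('a, 'b) graded_module \<Rightarrow> int \<Rightarrow> 'b set" where
  "grade_above M a = generate (add_monoid M) (\<Union>i\<in>{a<..}. grade M i)"


section \<open>Complexes\<close>

text \<open>
  Complexes are indexed by the integers, with differential \<open>D i\<close> from \<open>C i\<close> to \<open>C (i - 1)\<close>.
\<close>

definition cycles ::
  "(int \<Rightarrow> ('a, 'b) graded_module) \<Rightarrow> (int \<Rightarrow> 'b \<Rightarrow> 'b) \<Rightarrow> int \<Rightarrow> ('a, 'b) graded_module" where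
  "cycles C D i = submod (C i) {x \<in> carrier (C i). D i x = \<zero>\<^bsub>C (i - 1)\<^esub>}"

definition boundaries ::
  "(int \<Rightarrow> ('a, 'b) graded_module) \<Rightarrow> (int \<Rightarrow> 'b \<Rightarrow> 'b) \<Rightarrow> int \<Rightarrow> ('a, 'b) graded_module" where
  "boundaries C D i = submod (C i) (D (i + 1) ` carrier (C (i + 1)))"

definition homology ::
  "(int \<Rightarrow> ('a, 'b) graded_module) \<Rightarrow> (int \<Rightarrow> 'b \<Rightarrow> 'b) \<Rightarrow> int \<Rightarrow> ('a, 'b set) graded_module" where
  "homology C D i = quot (cycles C D i) (carrier (boundaries C D i))"

text \<open>\<open>fg_complex n l C D\<close>: a complex $0 \to C_l \to \cdots \to C_0 \to 0$ of finitely generated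
  graded modules over the polynomial ring in \<open>n\<close> variables, with maps of degree 0.\<close>

definition fg_complex ::
  "nat \<Rightarrow> nat \<Rightarrow> (int \<Rightarrow> ('k::field mpoly, 'b) graded_module) \<Rightarrow> (int \<Rightarrow> 'b \<Rightarrow> 'b) \<Rightarrow> bool" where
  "fg_complex n l C D \<longleftrightarrow>
     (\<forall>i. graded_mpoly_module n (C i) \<and> fin_gen n (C i)) \<and>
     (\<forall>i. i \<notin> {0..int l} \<longrightarrow> carrier (C i) = {\<zero>\<^bsub>C i\<^esub>}) \<and>
     (\<forall>i. D i \<in> graded_hom n (C i) (C (i - 1))) \<and>
     (\<forall>i. \<forall>x\<in>carrier (C (i + 1)). D i (D (i + 1) x) = \<zero>\<^bsub>C (i - 1)\<^esub>)"


section \<open>Local cohomology\<close>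

text \<open>
  The local cohomology with support in the ideal generated by all variables is the cohomology
  of the \<^emph>\<open>Cech complex\<close> on the variables
  \[ 0 \to M \to \bigoplus_i M_{X_i} \to \bigoplus_{i<j} M_{X_i X_j} \to \cdots
       \to M_{X_1 \cdots X_n} \to 0. \]
  For a set \<open>S\<close> of variables, \<open>localization M S\<close> is \<open>M\<close> with the variables in \<open>S\<close> inverted.
  The class \<open>frac M S (x, e)\<close> is the fraction $x / X^e$, where \<open>e\<close> is supported in \<open>S\<close>; it is
  homogeneous of degree \<open>d\<close> if \<open>x\<close> is homogeneous of degree $d + |e|$.
\<close>

definition frac ::
  "('k::field mpoly, 'b) graded_module \<Rightarrow> nat set \<Rightarrow> 'b \<times> (nat \<Rightarrow>\<^sub>0 nat) \<Rightarrow> ('b \<times> (nat \<Rightarrow>\<^sub>0 nat)) set"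
  where
  "frac M S = (\<lambda>(x, e). {(y, f). y \<in> carrier M \<and> Poly_Mapping.keys f \<subseteq> S \<and>
     (\<exists>u. Poly_Mapping.keys u \<subseteq> S \<and> monom (u + f) \<odot>\<^bsub>M\<^esub> x = monom (u + e) \<odot>\<^bsub>M\<^esub> y)})"

definition localization ::
  "('k::field mpoly, 'b) graded_module \<Rightarrow> nat set \<Rightarrow>
     ('k mpoly, ('b \<times> (nat \<Rightarrow>\<^sub>0 nat)) set) graded_module" where
  "localization M S =
     \<lparr>carrier = frac M S ` (carrier M \<times> {e. Poly_Mapping.keys e \<subseteq> S}),
      mult = undefined, one = undefined,
      zero = frac M S (\<zero>\<^bsub>M\<^esub>, 0),
      add = (\<lambda>A B. \<Union>(x, e)\<in>A. \<Union>(y, f)\<in>B.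
               frac M S (monom f \<odot>\<^bsub>M\<^esub> x \<oplus>\<^bsub>M\<^esub> monom e \<odot>\<^bsub>M\<^esub> y, e + f)),
      smult = (\<lambda>r A. \<Union>(x, e)\<in>A. frac M S (r \<odot>\<^bsub>M\<^esub> x, e)),
      grade = (\<lambda>d. {frac M S (x, e) | x e.
                 Poly_Mapping.keys e \<subseteq> S \<and> x \<in> grade M (d + int (monom_degree e))})\<rparr>"

text \<open>For \<open>S \<subseteq> T\<close>, the canonical map \<open>localization M S \<rightarrow> localization M T\<close>.\<close>

definition localization_map ::
  "('k::field mpoly, 'b) graded_module \<Rightarrow> nat set \<Rightarrow>
     ('b \<times> (nat \<Rightarrow>\<^sub>0 nat)) set \<Rightarrow> ('b \<times> (nat \<Rightarrow>\<^sub>0 nat)) set" where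
  "localization_map M T A = (\<Union>z\<in>A. frac M T z)"

text \<open>
  \<open>cech n M p\<close> is the direct sum of the \<open>localization M S\<close> over the \<open>p\<close>-element sets \<open>S\<close> of
  variables (in particular it is the zero module for \<open>p < 0\<close> and for \<open>p > n\<close>), and
  \<open>cech_diff n M p\<close> is the differential to \<open>cech n M (p + 1)\<close>.
\<close>

definition cech_index :: "nat \<Rightarrow> int \<Rightarrow> nat set set" where
  "cech_index n p = {S. S \<subseteq> {..<n} \<and> int (card S) = p}"

definition cech ::
  "nat \<Rightarrow> ('k::field mpoly, 'b) graded_module \<Rightarrow> int \<Rightarrow>
     ('k mpoly, nat set \<Rightarrow> ('b \<times> (nat \<Rightarrow>\<^sub>0 nat)) set) graded_module" where
  "cech n M p =
     \<lparr>carrier = (\<Pi>\<^sub>E S\<in>cech_index n p. carrier (localization M S)),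
      mult = undefined, one = undefined,
      zero = (\<lambda>S\<in>cech_index n p. \<zero>\<^bsub>localization M S\<^esub>),
      add = (\<lambda>c c'. \<lambda>S\<in>cech_index n p. c S \<oplus>\<^bsub>localization M S\<^esub> c' S),
      smult = (\<lambda>r c. \<lambda>S\<in>cech_index n p. r \<odot>\<^bsub>localization M S\<^esub> c S),
      grade = (\<lambda>d. \<Pi>\<^sub>E S\<in>cech_index n p. grade (localization M S) d)\<rparr>"

definition cech_diff ::
  "nat \<Rightarrow> ('k::field mpoly, 'b) graded_module \<Rightarrow> int \<Rightarrow>
     (nat set \<Rightarrow> ('b \<times> (nat \<Rightarrow>\<^sub>0 nat)) set) \<Rightarrow> (nat set \<Rightarrow> ('b \<times> (nat \<Rightarrow>\<^sub>0 nat)) set)" where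
  "cech_diff n M p c =
     (\<lambda>T\<in>cech_index n (p + 1). \<Oplus>\<^bsub>localization M T\<^esub> j\<in>T.
        (-1) ^ card {l \<in> T. l < j} \<odot>\<^bsub>localization M T\<^esub> localization_map M T (c (T - {j})))"

text \<open>The cochain complex is turned into a chain complex by negating degrees.\<close>

definition local_cohomology ::
  "nat \<Rightarrow> nat \<Rightarrow> ('k::field mpoly, 'b) graded_module \<Rightarrow>
     ('k mpoly, (nat set \<Rightarrow> ('b \<times> (nat \<Rightarrow>\<^sub>0 nat)) set) set) graded_module" where
  "local_cohomology n i M =
     homology (\<lambda>j. cech n M (- j)) (\<lambda>j. cech_diff n M (- j)) (- int i)"


section \<open>Regularity with respect to a set of cohomological indices\<close>

text \<open>\<open>regular_wrt n X m M\<close>: \<open>M\<close> is \<open>m\<close>-regular with respect to \<open>X\<close>.\<close>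

definition regular_wrt ::
  "nat \<Rightarrow> nat set \<Rightarrow> int \<Rightarrow> ('k::field mpoly, 'b) graded_module \<Rightarrow> bool" where
  "regular_wrt n X m M \<longleftrightarrow>
     (\<forall>i\<in>X. grade_above (local_cohomology n i M) (m - int i) = {\<zero>\<^bsub>local_cohomology n i M\<^esub>})"

definition shift :: "nat set \<Rightarrow> int \<Rightarrow> nat set" where
  "shift X a = {j. \<exists>i\<in>X. int j = int i + a}"

end

theory Submission
  imports Defs
begin

text \<open>
  Both parts are inductions along the complex, one from each end, using the long exact sequences of local
  cohomology of \<open>0 \<rightarrow> B\<^sub>i \<rightarrow> Z\<^sub>i \<rightarrow> H\<^sub>i \<rightarrow> 0\<close> and \<open>0 \<rightarrow> Z\<^sub>i \<rightarrow> C\<^sub>i \<rightarrow> B\<^sub>i\<^sub>-\<^sub>1 \<rightarrow> 0\<close>: in a fixed degree, if the two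
  neighbours of a term of such a sequence vanish, so does the term. Only these three-term consequences
  are needed. They are diagram chases with families of module elements, since after clearing
  denominators the Cech complex is the direct limit of the Koszul complexes of the powers of the
  variables; projections onto homogeneous components keep the chases in the prescribed degree.
\<close>


section \<open>Monomials\<close>

text \<open>Shifting the index set by \<open>a\<close> while raising \<open>m\<close> by
  \<open>a\<close> leaves the degree bound alone: at cohomological index \<open>j + a\<close> it
  reads \<open>m + a - (j + a) = m - j\<close>. So each induction fixes \<open>j\<close> in
  \<open>X\<close> and a degree \<open>d > m - j\<close>, and only the cohomological index moves
  with the position in the complex. The obstacle is the encoding: local cohomology consists of
  cosets of families of classes of fractions. \<open>lc_vanish\<close> trades this for equations
  between elements of \<open>M\<close>. The exchange is possible because the Cech complex has
  finitely many index sets in each position: one exponent \<open>N\<close> serves as denominator for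
  a whole cochain, and one further exponent \<open>K\<close> turns finitely many equalities of
  fractions into equalities in \<open>M\<close>. The price is that every equality holds only after
  multiplication by a power of the variables, so each chase raises the exponent once per hypothesis
  used. A vanishing hypothesis accepts only homogeneous cochains but returns an arbitrary one.
  Whatever it returns is projected to its component of the right degree before it enters the next
  hypothesis.\<close>

lemma monom_0: "monom 0 = 1"
  by (simp add: monom_def)

lemma monom_add: "monom (s + t) = monom s * monom t"
  by (simp add: monom_def mult_single)

text \<open>Natural number exponents cannot cancel, so the support of a sum is the whole union. Thus
  a product of monomials is supported in \<open>S\<close> exactly when both factors are.\<close>

lemma keys_nat_add: "Poly_Mapping.keys (s + t) = Poly_Mapping.keys s \<union> Poly_Mapping.keys t"
  for s t :: "nat \<Rightarrow>\<^sub>0 nat"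
  by (auto simp: in_keys_iff lookup_add)

lemma monom_degree_alt:
  assumes "finite S" "Poly_Mapping.keys t \<subseteq> S"
  shows "monom_degree t = (\<Sum>i\<in>S. Poly_Mapping.lookup t i)"
  unfolding monom_degree_def
  by (rule sum.mono_neutral_left) (use assms in \<open>auto simp: in_keys_iff\<close>)

lemma monom_degree_add: "monom_degree (s + t) = monom_degree s + monom_degree t"
proof -
  let ?S = "Poly_Mapping.keys s \<union> Poly_Mapping.keys t"
  show ?thesis
    by (simp add: monom_degree_alt[of ?S] lookup_add sum.distrib keys_nat_add)
qed

lemma monom_degree_single: "monom_degree (Poly_Mapping.single j N) = N"
  by (simp add: monom_degree_def)

text \<open>The exponent of the \<open>N\<close>-th power of the product of the variables in
  \<open>S\<close>. These powers are cofinal among the monomials supported in \<open>S\<close>, so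
  they can serve as the only denominators.\<close>

definition var_power :: "nat set \<Rightarrow> nat \<Rightarrow> (nat \<Rightarrow>\<^sub>0 nat)" where
  "var_power S N = (\<Sum>i\<in>S. Poly_Mapping.single i N)"

lemma lookup_var_power:
  "finite S \<Longrightarrow> Poly_Mapping.lookup (var_power S N) i = (if i \<in> S then N else 0)"
  by (simp add: var_power_def lookup_sum lookup_single when_def)

lemma keys_var_power: "finite S \<Longrightarrow> Poly_Mapping.keys (var_power S N) \<subseteq> S"
  by (auto simp: in_keys_iff lookup_var_power split: if_splits)

lemma var_power_add: "var_power S (N + K) = var_power S N + var_power S K"
  by (simp add: var_power_def single_add sum.distrib)

lemma var_power_remove:
  "finite T \<Longrightarrow> j \<in> T \<Longrightarrow> var_power T N = var_power (T - {j}) N + Poly_Mapping.single j N"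
  by (simp add: var_power_def sum.remove add.commute)

lemma monom_degree_var_power: "finite S \<Longrightarrow> monom_degree (var_power S N) = N * card S"
  by (simp add: monom_degree_alt[OF _ keys_var_power] lookup_var_power)

lemma var_power_complement:
  assumes "finite S" "Poly_Mapping.keys e \<subseteq> S" "\<forall>i. Poly_Mapping.lookup e i \<le> N"
  obtains f where "Poly_Mapping.keys f \<subseteq> S" "e + f = var_power S N"
proof
  let ?f = "var_power S N - e"
  show "Poly_Mapping.keys ?f \<subseteq> S"
    using assms by (auto simp: in_keys_iff lookup_minus lookup_var_power split: if_splits)
  show "e + ?f = var_power S N"
    using assms
    by (intro poly_mapping_eqI) (auto simp: lookup_add lookup_minus lookup_var_power in_keys_iff)
qed

lemma lookup_bounded: "\<exists>N. \<forall>i. Poly_Mapping.lookup e i \<le> N" for e :: "nat \<Rightarrow>\<^sub>0 nat"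
proof
  show "\<forall>i. Poly_Mapping.lookup e i \<le> monom_degree e"
  proof
    fix i
    show "Poly_Mapping.lookup e i \<le> monom_degree e"
      unfolding monom_degree_def
      by (cases "i \<in> Poly_Mapping.keys e") (auto intro: member_le_sum simp: in_keys_iff)
  qed
qed

section \<open>Index sets of the Cech complex\<close>

lemma finite_cech_index: "finite (cech_index n p)"
  by (simp add: cech_index_def)

lemma cech_indexD:
  assumes "S \<in> cech_index n p"
  shows "S \<subseteq> {..<n}" "finite S" "int (card S) = p"
  using assms finite_subset[of S "{..<n}"] by (auto simp: cech_index_def)

lemma cech_index_remove:
  assumes "T \<in> cech_index n (p + 1)" "j \<in> T"
  shows "T - {j} \<in> cech_index n p"
proof -
  have "card T = Suc (card (T - {j}))"
    using cech_indexD(2)[OF assms(1)] assms(2) by (rule card.remove)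
  then show ?thesis
    using cech_indexD(1,3)[OF assms(1)] by (auto simp: cech_index_def)
qed

lemma cech_index_remove': "T \<in> cech_index n p \<Longrightarrow> j \<in> T \<Longrightarrow> T - {j} \<in> cech_index n (p - 1)"
  using cech_index_remove[of T n "p - 1" j] by simp


section \<open>Localizations\<close>

locale mpoly_module = module "mpoly_ring n" M
  for n :: nat and M :: "('k::field mpoly, 'b) graded_module" (structure)
begin

lemma monom_carrier:
  "Poly_Mapping.keys t \<subseteq> {..<n} \<Longrightarrow> monom t \<in> carrier (mpoly_ring n :: 'k mpoly ring)"
  by (auto simp: monom_def mpoly_ring_def)

lemma sign_carrier: "(-1) ^ k \<in> carrier (mpoly_ring n :: 'k mpoly ring)"
  by (cases "even k") (auto simp: mpoly_ring_def)

lemma monom_smult_closed [simp]: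
  "Poly_Mapping.keys t \<subseteq> {..<n} \<Longrightarrow> x \<in> carrier M \<Longrightarrow> monom t \<odot> x \<in> carrier M"
  by (simp add: monom_carrier)

lemma sign_smult_closed [simp]: "x \<in> carrier M \<Longrightarrow> (-1) ^ k \<odot> x \<in> carrier M"
  by (simp add: sign_carrier)

lemma monom_smult_smult [simp]:
  assumes "Poly_Mapping.keys s \<subseteq> {..<n}" "Poly_Mapping.keys t \<subseteq> {..<n}" "x \<in> carrier M"
  shows "monom s \<odot> (monom t \<odot> x) = monom (s + t) \<odot> x"
  using smult_assoc1[of "monom s" "monom t" x] assms monom_carrier
  by (simp add: mpoly_ring_def monom_add)

lemma monom_0_smult [simp]: "x \<in> carrier M \<Longrightarrow> monom 0 \<odot> x = x"
  using smult_one[of x] by (simp add: mpoly_ring_def monom_0)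

lemma monom_smult_add:
  "Poly_Mapping.keys t \<subseteq> {..<n} \<Longrightarrow> x \<in> carrier M \<Longrightarrow> y \<in> carrier M \<Longrightarrow>
    monom t \<odot> (x \<oplus> y) = monom t \<odot> x \<oplus> monom t \<odot> y"
  by (simp add: smult_r_distr monom_carrier)

text \<open>\<open>cech_diff\<close> takes its signs from the type class operations on polynomials,
  while the module laws use the negation of the ring record. This identifies the two.\<close>

lemma mpoly_minus_one: "\<ominus>\<^bsub>mpoly_ring n\<^esub> \<one>\<^bsub>mpoly_ring n\<^esub> = (-1 :: 'k mpoly)"
proof -
  have "-1 \<in> carrier (mpoly_ring n :: 'k mpoly ring)"
    using sign_carrier[of 1] by simp
  then show ?thesis
    by (intro R.minus_equality) (auto simp: mpoly_ring_def)
qed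

lemma sign_smult: "x \<in> carrier M \<Longrightarrow> (-1) ^ k \<odot> x = (if even k then x else \<ominus> x)"
proof -
  assume x: "x \<in> carrier M"
  have 1: "1 \<odot> x = x"
    using smult_one[OF x] by (simp add: mpoly_ring_def)
  have "(-1) \<odot> x = \<ominus> x"
    using smult_l_minus[OF R.one_closed x] x by (simp add: mpoly_minus_one)
  with 1 show ?thesis
    by (cases "even k") auto
qed

lemma monom_smult_minus:
  "Poly_Mapping.keys t \<subseteq> {..<n} \<Longrightarrow> x \<in> carrier M \<Longrightarrow> monom t \<odot> (\<ominus> x) = \<ominus> (monom t \<odot> x)"
  by (simp add: smult_r_minus monom_carrier)

lemma monom_sign_smult:
  "Poly_Mapping.keys t \<subseteq> {..<n} \<Longrightarrow> x \<in> carrier M \<Longrightarrow>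
    monom t \<odot> ((-1) ^ k \<odot> x) = (-1) ^ k \<odot> (monom t \<odot> x)"
  by (simp add: sign_smult monom_smult_minus)

end

section \<open>Fractions with monomial denominators\<close>

locale localized = mpoly_module +
  fixes S :: "nat set"
  assumes S_subset: "S \<subseteq> {..<n}"
begin

abbreviation "L \<equiv> localization M S"

lemma S_finite: "finite S"
  using S_subset finite_subset by blast

lemma keys_n [simp]: "Poly_Mapping.keys t \<subseteq> S \<Longrightarrow> Poly_Mapping.keys t \<subseteq> {..<n}"
  for t :: "nat \<Rightarrow>\<^sub>0 nat"
  using S_subset by blast

lemma mem_frac: "(y, f) \<in> frac M S (x, e) \<longleftrightarrow> y \<in> carrier M \<and> Poly_Mapping.keys f \<subseteq> S \<and>
     (\<exists>u. Poly_Mapping.keys u \<subseteq> S \<and> monom (u + f) \<odot> x = monom (u + e) \<odot> y)"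
  by (simp add: frac_def)

lemma frac_self: "x \<in> carrier M \<Longrightarrow> Poly_Mapping.keys e \<subseteq> S \<Longrightarrow> (x, e) \<in> frac M S (x, e)"
  by (force simp: mem_frac intro: exI[of _ 0])

text \<open>Transitivity of equality of fractions. If \<open>u\<close> witnesses the equality of the
  fractions of \<open>x\<close> and \<open>y\<close>, and \<open>v\<close> that of \<open>y\<close>
  and \<open>z\<close>, then passing through the middle denominator \<open>f\<close> gives the
  witness \<open>u + v + f\<close> for \<open>x\<close> and \<open>z\<close>.\<close>

lemma frac_subset:
  assumes x: "x \<in> carrier M" "Poly_Mapping.keys e \<subseteq> S" and y: "y \<in> carrier M" "Poly_Mapping.keys f \<subseteq> S"
    and u: "Poly_Mapping.keys u \<subseteq> S" "monom (u + f) \<odot> x = monom (u + e) \<odot> y"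
  shows "frac M S (y, f) \<subseteq> frac M S (x, e)"
proof clarify
  fix z g assume "(z, g) \<in> frac M S (y, f)"
  then obtain v where z: "z \<in> carrier M" "Poly_Mapping.keys g \<subseteq> S" and
    v: "Poly_Mapping.keys v \<subseteq> S" "monom (v + g) \<odot> y = monom (v + f) \<odot> z"
    by (auto simp: mem_frac)
  have "monom ((u + v + f) + g) \<odot> x = monom (v + g) \<odot> (monom (u + f) \<odot> x)"
    using x y z u(1) v(1) by (simp add: keys_nat_add add_ac)
  also have "\<dots> = monom (v + g) \<odot> (monom (u + e) \<odot> y)"
    by (simp only: u)
  also have "\<dots> = monom (u + e) \<odot> (monom (v + g) \<odot> y)"
    using x y z u(1) v(1) by (simp add: keys_nat_add add_ac)
  also have "\<dots> = monom (u + e) \<odot> (monom (v + f) \<odot> z)"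
    by (simp only: v)
  also have "\<dots> = monom ((u + v + f) + e) \<odot> z"
    using x y z u(1) v(1) by (simp add: keys_nat_add add_ac)
  finally show "(z, g) \<in> frac M S (x, e)"
    using x y z u(1) v(1) by (auto simp: mem_frac keys_nat_add intro!: exI[of _ "u + v + f"])
qed

lemma frac_eqI:
  assumes "x \<in> carrier M" "Poly_Mapping.keys e \<subseteq> S" "y \<in> carrier M" "Poly_Mapping.keys f \<subseteq> S"
    "Poly_Mapping.keys u \<subseteq> S" "monom (u + f) \<odot> x = monom (u + e) \<odot> y"
  shows "frac M S (x, e) = frac M S (y, f)"
  using frac_subset[OF assms] frac_subset[OF assms(3,4,1,2,5) assms(6)[symmetric]] by blast

lemma frac_eq_iff:
  assumes "x \<in> carrier M" "Poly_Mapping.keys e \<subseteq> S" "y \<in> carrier M" "Poly_Mapping.keys f \<subseteq> S"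
  shows "frac M S (x, e) = frac M S (y, f) \<longleftrightarrow>
    (\<exists>u. Poly_Mapping.keys u \<subseteq> S \<and> monom (u + f) \<odot> x = monom (u + e) \<odot> y)"
proof
  assume "frac M S (x, e) = frac M S (y, f)"
  then have "(y, f) \<in> frac M S (x, e)"
    using frac_self[of y f] assms by simp
  then show "\<exists>u. Poly_Mapping.keys u \<subseteq> S \<and> monom (u + f) \<odot> x = monom (u + e) \<odot> y"
    by (simp add: mem_frac)
qed (use frac_eqI[OF assms] in blast)

lemma mem_frac_eq:
  assumes "x \<in> carrier M" "Poly_Mapping.keys e \<subseteq> S" "(y, f) \<in> frac M S (x, e)"
  shows "y \<in> carrier M" "Poly_Mapping.keys f \<subseteq> S" "frac M S (y, f) = frac M S (x, e)"
  using assms frac_eqI[of x e y f] by (auto simp: mem_frac)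

lemma frac_cancel:
  assumes "x \<in> carrier M" "Poly_Mapping.keys e \<subseteq> S" "Poly_Mapping.keys f \<subseteq> S"
  shows "frac M S (monom f \<odot> x, f + e) = frac M S (x, e)"
  using assms by (intro frac_eqI[where u = 0]) (auto simp: keys_nat_add add_ac)

lemma frac_zero: "Poly_Mapping.keys e \<subseteq> S \<Longrightarrow> frac M S (\<zero>, e) = \<zero>\<^bsub>L\<^esub>"
  by (simp add: localization_def)
    (intro frac_eqI[where u = 0], auto simp: monom_carrier)

lemma frac_closed: "x \<in> carrier M \<Longrightarrow> Poly_Mapping.keys e \<subseteq> S \<Longrightarrow> frac M S (x, e) \<in> carrier L"
  by (auto simp: localization_def)

lemma localization_cases:
  assumes "A \<in> carrier L"
  obtains x e where "x \<in> carrier M" "Poly_Mapping.keys e \<subseteq> S" "A = frac M S (x, e)"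
  using assms by (auto simp: localization_def)

text \<open>Addition is encoded as a union over all representatives. It has the expected value
  because all sets in the union coincide, which is well-definedness (\<open>const\<close>), and
  because the union is not empty (\<open>frac_self\<close>). Scalar multiplication and the
  localization maps are treated the same way.\<close>

lemma frac_add:
  assumes x: "x \<in> carrier M" "Poly_Mapping.keys e \<subseteq> S" and y: "y \<in> carrier M" "Poly_Mapping.keys f \<subseteq> S"
  shows "frac M S (x, e) \<oplus>\<^bsub>L\<^esub> frac M S (y, f) = frac M S (monom f \<odot> x \<oplus> monom e \<odot> y, e + f)"
proof -
  let ?g = "\<lambda>x e y f. frac M S (monom f \<odot> x \<oplus> monom e \<odot> y, e + f)"
  have const: "?g x' e' y' f' = ?g x e y f"
    if x': "(x', e') \<in> frac M S (x, e)" and y': "(y', f') \<in> frac M S (y, f)" for x' e' y' f'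
  proof -
    obtain u v where u: "Poly_Mapping.keys u \<subseteq> S" "monom (u + e') \<odot> x = monom (u + e) \<odot> x'"
      and v: "Poly_Mapping.keys v \<subseteq> S" "monom (v + f') \<odot> y = monom (v + f) \<odot> y'"
      using x' y' by (auto simp: mem_frac)
    note c = x y mem_frac_eq(1,2)[OF x x'] mem_frac_eq(1,2)[OF y y'] u(1) v(1)
    \<comment> \<open>Each of the two equations is multiplied by the witness of the other and by
      both denominators of the other summand. Added up, they compare the two cross-multiplied sums
      with witness \<open>u + v\<close>.\<close>
    have "monom (v + f' + f) \<odot> (monom (u + e') \<odot> x) = monom (v + f' + f) \<odot> (monom (u + e) \<odot> x')"
      by (simp only: u)
    moreover have "monom (u + e' + e) \<odot> (monom (v + f') \<odot> y) = monom (u + e' + e) \<odot> (monom (v + f) \<odot> y')"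
      by (simp only: v)
    ultimately have "monom (u + v + (e + f)) \<odot> (monom f' \<odot> x' \<oplus> monom e' \<odot> y') =
        monom (u + v + (e' + f')) \<odot> (monom f \<odot> x \<oplus> monom e \<odot> y)"
      using c by (simp add: keys_nat_add monom_smult_add add_ac)
    with c show ?thesis
      by (intro frac_eqI[where u = "u + v"]) (simp_all add: keys_nat_add)
  qed
  have "frac M S (x, e) \<oplus>\<^bsub>L\<^esub> frac M S (y, f) =
      (\<Union>(x', e')\<in>frac M S (x, e). \<Union>(y', f')\<in>frac M S (y, f). ?g x' e' y' f')"
    by (simp add: localization_def)
  also have "\<dots> = (\<Union>z\<in>frac M S (x, e). \<Union>w\<in>frac M S (y, f). ?g x e y f)"
    unfolding split_def by (intro SUP_cong refl const) simp_all
  also have "\<dots> = ?g x e y f"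
    using frac_self[OF x] frac_self[OF y] by blast
  finally show ?thesis .
qed

lemma frac_add_same:
  assumes "x \<in> carrier M" "y \<in> carrier M" "Poly_Mapping.keys e \<subseteq> S"
  shows "frac M S (x, e) \<oplus>\<^bsub>L\<^esub> frac M S (y, e) = frac M S (x \<oplus> y, e)"
  using assms frac_cancel[of "x \<oplus> y" e e]
  by (simp add: frac_add monom_smult_add)

lemma frac_smult:
  assumes r: "r \<in> carrier (mpoly_ring n)" and x: "x \<in> carrier M" "Poly_Mapping.keys e \<subseteq> S"
  shows "r \<odot>\<^bsub>L\<^esub> frac M S (x, e) = frac M S (r \<odot> x, e)"
proof -
  have comm: "monom t \<odot> (r \<odot> z) = r \<odot> (monom t \<odot> z)"
    if "Poly_Mapping.keys t \<subseteq> {..<n}" "z \<in> carrier M" for t z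
    using that r monom_carrier[of t] R.m_comm[of "monom t" r]
    by (simp add: smult_assoc1[symmetric])
  have const: "frac M S (r \<odot> x', e') = frac M S (r \<odot> x, e)" if x': "(x', e') \<in> frac M S (x, e)" for x' e'
  proof -
    obtain u where u: "Poly_Mapping.keys u \<subseteq> S" "monom (u + e') \<odot> x = monom (u + e) \<odot> x'"
      using x' by (auto simp: mem_frac)
    show ?thesis
      using x mem_frac_eq(1,2)[OF x x'] u r
      by (intro frac_eqI[where u = u]) (auto simp: comm keys_nat_add)
  qed
  have "r \<odot>\<^bsub>L\<^esub> frac M S (x, e) = (\<Union>(x', e')\<in>frac M S (x, e). frac M S (r \<odot> x', e'))"
    by (simp add: localization_def)
  also have "\<dots> = (\<Union>z\<in>frac M S (x, e). frac M S (r \<odot> x, e))"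
    by (intro SUP_cong refl) (clarsimp simp: const)
  also have "\<dots> = frac M S (r \<odot> x, e)"
    using frac_self[OF x] by blast
  finally show ?thesis .
qed

lemma common_denominator:
  assumes "A \<in> carrier L" "B \<in> carrier L"
  obtains x y e where "x \<in> carrier M" "y \<in> carrier M" "Poly_Mapping.keys e \<subseteq> S"
    "A = frac M S (x, e)" "B = frac M S (y, e)"
proof -
  obtain x e where x: "x \<in> carrier M" "Poly_Mapping.keys e \<subseteq> S" "A = frac M S (x, e)"
    using assms(1) by (rule localization_cases)
  obtain y f where y: "y \<in> carrier M" "Poly_Mapping.keys f \<subseteq> S" "B = frac M S (y, f)"
    using assms(2) by (rule localization_cases)
  show thesis
    by (rule that[of "monom f \<odot> x" "monom e \<odot> y" "e + f"])
      (use x y frac_cancel[of x e f] frac_cancel[of y f e] in \<open>simp_all add: keys_nat_add add.commute\<close>)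
qed

text \<open>Over a common denominator, addition of fractions is addition of numerators, so the group
  laws are inherited from \<open>M\<close>.\<close>

lemma localization_group: "abelian_group L"
proof (rule abelian_groupI)
  show "\<zero>\<^bsub>L\<^esub> \<in> carrier L"
    using frac_zero[of 0] frac_closed[of \<zero> 0] by simp
next
  fix A B assume "A \<in> carrier L" "B \<in> carrier L"
  then obtain x y e where "x \<in> carrier M" "y \<in> carrier M" "Poly_Mapping.keys e \<subseteq> S"
    "A = frac M S (x, e)" "B = frac M S (y, e)"
    by (rule common_denominator)
  then show "A \<oplus>\<^bsub>L\<^esub> B \<in> carrier L" "A \<oplus>\<^bsub>L\<^esub> B = B \<oplus>\<^bsub>L\<^esub> A"
    by (simp_all add: frac_add_same a_comm frac_closed)
next
  fix A B C assume A: "A \<in> carrier L" and BC: "B \<in> carrier L" "C \<in> carrier L"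
  from A obtain x e where x: "x \<in> carrier M" "Poly_Mapping.keys e \<subseteq> S" "A = frac M S (x, e)"
    by (rule localization_cases)
  from BC obtain y z f where y: "y \<in> carrier M" "z \<in> carrier M" "Poly_Mapping.keys f \<subseteq> S"
      "B = frac M S (y, f)" "C = frac M S (z, f)"
    by (rule common_denominator)
  have "A = frac M S (monom f \<odot> x, e + f)" "B = frac M S (monom e \<odot> y, e + f)"
    "C = frac M S (monom e \<odot> z, e + f)"
    using x y frac_cancel[of x e f] frac_cancel[of y f e] frac_cancel[of z f e]
    by (simp_all add: add.commute)
  moreover have "Poly_Mapping.keys (e + f) \<subseteq> S"
    using x y by (simp add: keys_nat_add)
  ultimately show "A \<oplus>\<^bsub>L\<^esub> B \<oplus>\<^bsub>L\<^esub> C = A \<oplus>\<^bsub>L\<^esub> (B \<oplus>\<^bsub>L\<^esub> C)"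
    using x y by (simp add: frac_add_same a_assoc)
next
  fix A assume "A \<in> carrier L"
  then obtain x e where x: "x \<in> carrier M" "Poly_Mapping.keys e \<subseteq> S" "A = frac M S (x, e)"
    by (rule localization_cases)
  show "\<zero>\<^bsub>L\<^esub> \<oplus>\<^bsub>L\<^esub> A = A"
    using x frac_add_same[of \<zero> x e] by (simp add: frac_zero)
  show "\<exists>B\<in>carrier L. B \<oplus>\<^bsub>L\<^esub> A = \<zero>\<^bsub>L\<^esub>"
    using x by (intro bexI[of _ "frac M S (\<ominus> x, e)"]) (simp_all add: frac_add_same frac_closed l_neg frac_zero)
qed

lemma frac_finsum:
  assumes "finite J" "\<And>j. j \<in> J \<Longrightarrow> g j \<in> carrier M" "Poly_Mapping.keys e \<subseteq> S"
  shows "(\<Oplus>\<^bsub>L\<^esub>j\<in>J. frac M S (g j, e)) = frac M S (\<Oplus>j\<in>J. g j, e)"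
proof -
  interpret L: abelian_group L by (rule localization_group)
  from assms(1,2) show ?thesis
  proof induction
    case empty
    show ?case
      using assms(3) by (simp add: frac_zero)
  next
    case (insert j J)
    have "(\<Oplus>\<^bsub>L\<^esub>i\<in>insert j J. frac M S (g i, e)) =
        frac M S (g j, e) \<oplus>\<^bsub>L\<^esub> (\<Oplus>\<^bsub>L\<^esub>i\<in>J. frac M S (g i, e))"
      using insert by (intro L.finsum_insert) (auto simp: frac_closed assms(3))
    also have "\<dots> = frac M S (g j \<oplus> (\<Oplus>i\<in>J. g i), e)"
      using insert by (subst insert.IH) (simp_all add: frac_add_same assms(3) Pi_def)
    also have "g j \<oplus> (\<Oplus>i\<in>J. g i) = (\<Oplus>i\<in>insert j J. g i)"
      using insert by (intro finsum_insert[symmetric]) auto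
    finally show ?case .
  qed
qed

text \<open>A monomial witnessing an equality over \<open>S'\<close> is still available over
  \<open>S\<close>, so all representatives of a fraction give the same class.\<close>

lemma localization_map_frac:
  assumes "S' \<subseteq> S" "x \<in> carrier M" "Poly_Mapping.keys e \<subseteq> S'"
  shows "localization_map M S (frac M S' (x, e)) = frac M S (x, e)"
proof -
  interpret S': localized n M S'
    using assms S_subset by unfold_locales auto
  have "frac M S (x', e') = frac M S (x, e)" if "(x', e') \<in> frac M S' (x, e)" for x' e'
  proof (rule mem_frac_eq(3))
    show "x \<in> carrier M" "Poly_Mapping.keys e \<subseteq> S"
      using assms by auto
    show "(x', e') \<in> frac M S (x, e)"
      using that assms(1) unfolding mem_frac S'.mem_frac by blast
  qed
  then have "localization_map M S (frac M S' (x, e)) = (\<Union>z\<in>frac M S' (x, e). frac M S (x, e))"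
    unfolding localization_map_def by (intro SUP_cong refl) (simp add: split_paired_all)
  also have "\<dots> = frac M S (x, e)"
    using S'.frac_self[OF assms(2,3)] by blast
  finally show ?thesis .
qed

text \<open>Equality in the direct limit. A witness \<open>u\<close> divides
  \<open>var_power S K\<close> for all large \<open>K\<close>, so the equality can be multiplied up.
  Having it for all \<open>K\<close> beyond a bound, and not just for one, lets finitely many such
  equalities share an exponent.\<close>

lemma frac_var_power_eq_iff:
  assumes "x \<in> carrier M" "y \<in> carrier M"
  shows "frac M S (x, var_power S N) = frac M S (y, var_power S N) \<longleftrightarrow>
    (\<exists>K0. \<forall>K\<ge>K0. monom (var_power S K) \<odot> x = monom (var_power S K) \<odot> y)"
proof
  assume "frac M S (x, var_power S N) = frac M S (y, var_power S N)"
  then obtain u where u: "Poly_Mapping.keys u \<subseteq> S"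
    "monom (u + var_power S N) \<odot> x = monom (u + var_power S N) \<odot> y"
    using assms S_finite by (auto simp: frac_eq_iff keys_var_power)
  let ?u = "u + var_power S N"
  have keys: "Poly_Mapping.keys ?u \<subseteq> S"
    using u S_finite by (simp add: keys_nat_add keys_var_power)
  obtain K0 where K0: "\<forall>i. Poly_Mapping.lookup ?u i \<le> K0"
    using lookup_bounded by blast
  have "monom (var_power S K) \<odot> x = monom (var_power S K) \<odot> y" if le: "K \<ge> K0" for K
  proof -
    obtain f where f: "Poly_Mapping.keys f \<subseteq> S" "?u + f = var_power S K"
      by (rule var_power_complement[OF S_finite keys, of K])
        (use K0 le in \<open>auto intro: order.trans\<close>)
    have "monom f \<odot> (monom ?u \<odot> x) = monom f \<odot> (monom ?u \<odot> y)"
      by (simp only: u)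
    then show ?thesis
      using f keys assms by (simp add: add.commute)
  qed
  then show "\<exists>K0. \<forall>K\<ge>K0. monom (var_power S K) \<odot> x = monom (var_power S K) \<odot> y"
    by blast
next
  assume "\<exists>K0. \<forall>K\<ge>K0. monom (var_power S K) \<odot> x = monom (var_power S K) \<odot> y"
  then obtain K where K: "monom (var_power S K) \<odot> x = monom (var_power S K) \<odot> y"
    by blast
  have k: "Poly_Mapping.keys (var_power S N) \<subseteq> S" for N
    using S_finite by (simp add: keys_var_power)
  have "monom (var_power S N) \<odot> (monom (var_power S K) \<odot> x) =
      monom (var_power S N) \<odot> (monom (var_power S K) \<odot> y)"
    by (simp only: K)
  with assms k show "frac M S (x, var_power S N) = frac M S (y, var_power S N)"
    by (intro frac_eqI[where u = "var_power S K"]) (auto simp: add.commute)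
qed

text \<open>Again valid for all large \<open>N\<close>, to allow a common choice for finitely many
  fractions. The complement \<open>f\<close> stays visible because its degree is needed to find the
  degree of the new numerator.\<close>

lemma frac_var_power_denominator:
  assumes "x \<in> carrier M" "Poly_Mapping.keys e \<subseteq> S"
  obtains N0 where "\<And>N. N \<ge> N0 \<Longrightarrow> \<exists>f. Poly_Mapping.keys f \<subseteq> S \<and> f + e = var_power S N \<and>
    frac M S (x, e) = frac M S (monom f \<odot> x, var_power S N)"
proof -
  obtain N0 where N0: "\<forall>i. Poly_Mapping.lookup e i \<le> N0"
    using lookup_bounded by blast
  have "\<exists>f. Poly_Mapping.keys f \<subseteq> S \<and> f + e = var_power S N \<and>
    frac M S (x, e) = frac M S (monom f \<odot> x, var_power S N)" if le: "N \<ge> N0" for N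
  proof -
    obtain f where f: "Poly_Mapping.keys f \<subseteq> S" "e + f = var_power S N"
      by (rule var_power_complement[OF S_finite assms(2), of N])
        (use N0 le in \<open>auto intro: order.trans\<close>)
    then show ?thesis
      using frac_cancel[OF assms f(1)] by (auto simp: add.commute)
  qed
  then show thesis
    using that by blast
qed

end


section \<open>The Koszul description of Cech cohomology\<close>

text \<open>A new index \<open>a\<close> adds the row \<open>g a j\<close> and the column
  \<open>g j a\<close>, which cancel term by term. There are no diagonal terms, so the argument is
  valid in every characteristic. It is the combinatorial core of the square of the differential
  being zero.\<close>

lemma (in abelian_group) finsum_antisymmetric:
  assumes "finite T"
    and "\<And>j k. j \<in> T \<Longrightarrow> k \<in> T \<Longrightarrow> j \<noteq> k \<Longrightarrow> g j k \<in> carrier G"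
    and "\<And>j k. j \<in> T \<Longrightarrow> k \<in> T \<Longrightarrow> j \<noteq> k \<Longrightarrow> g k j = \<ominus> g j k"
  shows "(\<Oplus>j\<in>T. \<Oplus>k\<in>T - {j}. g j k) = \<zero>"
  using assms
proof (induction T)
  case empty
  show ?case by simp
next
  case (insert a T)
  have c: "g a j \<in> carrier G" "g j a \<in> carrier G" if "j \<in> T" for j
    using insert.prems(1) insert.hyps(2) that by auto
  have anti: "g j a = \<ominus> g a j" if "j \<in> T" for j
    using insert.prems(2)[of a j] insert.hyps(2) that by auto
  have c': "(\<Oplus>k\<in>T - {j}. g j k) \<in> carrier G" if "j \<in> T" for j
    using insert.prems(1) that by (intro finsum_closed) auto
  have "(\<Oplus>j\<in>insert a T. \<Oplus>k\<in>insert a T - {j}. g j k) =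
      (\<Oplus>k\<in>insert a T - {a}. g a k) \<oplus> (\<Oplus>j\<in>T. \<Oplus>k\<in>insert a T - {j}. g j k)"
    using insert.hyps insert.prems(1)
    by (intro finsum_insert) (auto intro!: finsum_closed)
  also have "insert a T - {a} = T"
    using insert.hyps by auto
  also have "(\<Oplus>j\<in>T. \<Oplus>k\<in>insert a T - {j}. g j k) = (\<Oplus>j\<in>T. g j a \<oplus> (\<Oplus>k\<in>T - {j}. g j k))"
  proof (rule finsum_cong')
    fix j assume j: "j \<in> T"
    have "insert a T - {j} = insert a (T - {j})"
      using insert.hyps j by auto
    moreover have "(\<Oplus>k\<in>insert a (T - {j}). g j k) = g j a \<oplus> (\<Oplus>k\<in>T - {j}. g j k)"
      using insert.hyps insert.prems(1) j c by (intro finsum_insert) auto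
    ultimately show "(\<Oplus>k\<in>insert a T - {j}. g j k) = g j a \<oplus> (\<Oplus>k\<in>T - {j}. g j k)"
      by simp
  qed (use c c' in auto)
  also have "\<dots> = (\<Oplus>j\<in>T. g j a) \<oplus> (\<Oplus>j\<in>T. \<Oplus>k\<in>T - {j}. g j k)"
    using c c' by (intro finsum_addf) auto
  also have "(\<Oplus>j\<in>T. \<Oplus>k\<in>T - {j}. g j k) = \<zero>"
    by (rule insert.IH; rule insert.prems; simp)
  also have "(\<Oplus>j\<in>T. g j a) = (\<Oplus>j\<in>T. \<ominus> g a j)"
    using anti c by (intro finsum_cong') auto
  also have "(\<Oplus>k\<in>T. g a k) \<oplus> ((\<Oplus>j\<in>T. \<ominus> g a j) \<oplus> \<zero>) = (\<Oplus>k\<in>T. g a k \<oplus> \<ominus> g a k)"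
    using c by (subst finsum_addf) (auto intro!: finsum_closed r_zero)
  also have "\<dots> = (\<Oplus>k\<in>T. \<zero>)"
    using c by (intro finsum_cong') (auto simp: r_neg)
  finally show ?case
    by simp
qed

text \<open>The Koszul differential for the powers $X_i^N$, as it acts on numerators: the factor
  $X_j^N$ appears when a fraction with denominator \<open>var_power (T - {j}) N\<close> is rewritten
  with denominator \<open>var_power T N\<close>.\<close>

definition koszul_diff ::
  "('k::field mpoly, 'b) graded_module \<Rightarrow> nat \<Rightarrow> (nat set \<Rightarrow> 'b) \<Rightarrow> nat set \<Rightarrow> 'b" where
  "koszul_diff M N y T = (\<Oplus>\<^bsub>M\<^esub>j\<in>T. (-1) ^ card {l \<in> T. l < j} \<odot>\<^bsub>M\<^esub>
     (monom (Poly_Mapping.single j N) \<odot>\<^bsub>M\<^esub> y (T - {j})))"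

text \<open>
  Writing Cech cochains with a common denominator \<open>var_power S N\<close> turns the Cech complex into the
  direct limit over \<open>N\<close> of the Koszul complexes of the powers $X_i^N$. \<open>lc_vanish n M p d\<close> says, in
  these terms, that the degree \<open>d\<close> part of the \<open>p\<close>-th local cohomology vanishes. The cochain \<open>y\<close>
  need not be homogeneous.
\<close>

definition lc_vanish :: "nat \<Rightarrow> ('k::field mpoly, 'b) graded_module \<Rightarrow> int \<Rightarrow> int \<Rightarrow> bool" where
  "lc_vanish n M p d \<longleftrightarrow> (\<forall>N x.
     (\<forall>S\<in>cech_index n p. x S \<in> grade M (d + int N * p)) \<and>
     (\<forall>T\<in>cech_index n (p + 1). koszul_diff M N x T = \<zero>\<^bsub>M\<^esub>) \<longrightarrow>
     (\<exists>K y. (\<forall>S\<in>cech_index n (p - 1). y S \<in> carrier M) \<and>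
        (\<forall>T\<in>cech_index n p.
           monom (var_power T K) \<odot>\<^bsub>M\<^esub> x T = koszul_diff M (N + K) y T)))"

lemma lc_vanishE:
  assumes "lc_vanish n M p d" "\<forall>S\<in>cech_index n p. x S \<in> grade M (d + int N * p)"
    "\<forall>T\<in>cech_index n (p + 1). koszul_diff M N x T = \<zero>\<^bsub>M\<^esub>"
  obtains K y where "\<forall>S\<in>cech_index n (p - 1). y S \<in> carrier M"
    "\<forall>T\<in>cech_index n p. monom (var_power T K) \<odot>\<^bsub>M\<^esub> x T = koszul_diff M (N + K) y T"
  using assms(1)[unfolded lc_vanish_def, THEN spec[of _ N], THEN spec[of _ x]] assms(2,3) by blast

lemma lc_vanish_neg: "p < 0 \<Longrightarrow> lc_vanish n M p d"
  by (simp add: lc_vanish_def cech_index_def)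

section \<open>Koszul differentials, and Cech cochains with a common denominator\<close>

context mpoly_module
begin

lemma keys_var_power_n: "T \<in> cech_index n p \<Longrightarrow> Poly_Mapping.keys (var_power T K) \<subseteq> {..<n}"
  using keys_var_power[of T K] cech_indexD[of T n p] by blast

lemma koszul_term_closed:
  assumes "T \<in> cech_index n p" "y \<in> cech_index n (p - 1) \<rightarrow> carrier M" "j \<in> T"
  shows "monom (Poly_Mapping.single j N) \<odot> y (T - {j}) \<in> carrier M"
  using assms cech_index_remove'[of T n p j] cech_indexD(1)[OF assms(1)]
  by (intro monom_smult_closed) auto

lemma koszul_diff_closed:
  assumes "T \<in> cech_index n p" "y \<in> cech_index n (p - 1) \<rightarrow> carrier M"
  shows "koszul_diff M N y T \<in> carrier M"
  unfolding koszul_diff_def using koszul_term_closed[where y = y, OF assms] by (intro finsum_closed) auto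

lemma koszul_diff_cong:
  assumes "T \<in> cech_index n p" "z \<in> cech_index n (p - 1) \<rightarrow> carrier M"
    "\<And>S. S \<in> cech_index n (p - 1) \<Longrightarrow> y S = z S"
  shows "koszul_diff M N y T = koszul_diff M N z T"
  unfolding koszul_diff_def using koszul_term_closed[where y = z, OF assms(1,2)] cech_index_remove'[OF assms(1)] assms(3)
  by (intro finsum_cong') auto

lemma koszul_diff_add:
  assumes "T \<in> cech_index n p" "y \<in> cech_index n (p - 1) \<rightarrow> carrier M"
    "z \<in> cech_index n (p - 1) \<rightarrow> carrier M"
  shows "koszul_diff M N (\<lambda>S. y S \<oplus> z S) T = koszul_diff M N y T \<oplus> koszul_diff M N z T"
proof -
  note y = koszul_term_closed[where y = y, OF assms(1,2)] and z = koszul_term_closed[where y = z, OF assms(1,3)]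
  have *: "(-1) ^ k \<odot> (monom (Poly_Mapping.single j N) \<odot> (y (T - {j}) \<oplus> z (T - {j}))) =
     (-1) ^ k \<odot> (monom (Poly_Mapping.single j N) \<odot> y (T - {j})) \<oplus>
     (-1) ^ k \<odot> (monom (Poly_Mapping.single j N) \<odot> z (T - {j}))" if "j \<in> T" for j k
    using that y[OF that] z[OF that] assms cech_index_remove'[OF assms(1) that]
      cech_indexD(1)[OF assms(1)]
    by (subst monom_smult_add) (auto simp: smult_r_distr sign_carrier)
  have "koszul_diff M N (\<lambda>S. y S \<oplus> z S) T =
    (\<Oplus>j\<in>T. (-1) ^ card {l \<in> T. l < j} \<odot> (monom (Poly_Mapping.single j N) \<odot> y (T - {j})) \<oplus>
     (-1) ^ card {l \<in> T. l < j} \<odot> (monom (Poly_Mapping.single j N) \<odot> z (T - {j})))"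
    unfolding koszul_diff_def using y z * by (intro finsum_cong') auto
  also have "\<dots> = koszul_diff M N y T \<oplus> koszul_diff M N z T"
    unfolding koszul_diff_def using y z by (intro finsum_addf) auto
  finally show ?thesis .
qed

text \<open>Multiplication by \<open>monom (var_power S K)\<close> is the transition map from level
  \<open>N\<close> to level \<open>N + K\<close> of the direct system, and it commutes with the
  differentials: the factor of \<open>T\<close> splits into that of \<open>T - {j}\<close> and
  $X_j^K$, which turns $X_j^N$ into $X_j^{N+K}$.\<close>

lemma koszul_diff_scale:
  assumes "T \<in> cech_index n p" "y \<in> cech_index n (p - 1) \<rightarrow> carrier M"
  shows "monom (var_power T K) \<odot> koszul_diff M N y T =
    koszul_diff M (N + K) (\<lambda>S. monom (var_power S K) \<odot> y S) T"
proof -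
  note y = koszul_term_closed[where y = y, OF assms]
  note T = cech_indexD(1,2)[OF assms(1)]
  have *: "monom (var_power T K) \<odot> ((-1) ^ k \<odot> (monom (Poly_Mapping.single j N) \<odot> y (T - {j}))) =
     (-1) ^ k \<odot> (monom (Poly_Mapping.single j (N + K)) \<odot> (monom (var_power (T - {j}) K) \<odot> y (T - {j})))"
    if "j \<in> T" for j k
  proof -
    have "y (T - {j}) \<in> carrier M" "Poly_Mapping.keys (var_power (T - {j}) K) \<subseteq> {..<n}" "j < n"
      using funcset_mem[OF assms(2)] cech_index_remove'[OF assms(1) that] T that keys_var_power_n by auto
    then show ?thesis
      using y[OF that] keys_var_power_n[OF assms(1)] that T
      by (simp add: monom_sign_smult var_power_remove[of T j] single_add keys_nat_add add_ac)
  qed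
  have scaled: "(\<lambda>S. monom (var_power S K) \<odot> y S) \<in> cech_index n (p - 1) \<rightarrow> carrier M"
    using funcset_mem[OF assms(2)] keys_var_power_n by auto
  have "monom (var_power T K) \<odot> koszul_diff M N y T = (\<Oplus>j\<in>T. monom (var_power T K) \<odot>
      ((-1) ^ card {l \<in> T. l < j} \<odot> (monom (Poly_Mapping.single j N) \<odot> y (T - {j}))))"
    unfolding koszul_diff_def using y T keys_var_power_n[OF assms(1)]
    by (intro finsum_smult_ldistr) (auto simp: monom_carrier)
  also have "\<dots> = koszul_diff M (N + K) (\<lambda>S. monom (var_power S K) \<odot> y S) T"
    unfolding koszul_diff_def using * koszul_term_closed[OF assms(1) scaled]
    by (intro finsum_cong') auto
  finally show ?thesis .
qed

text \<open>The double sum runs over ordered pairs of distinct elements of \<open>T\<close>, and its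
  terms are antisymmetric in the pair.\<close>

lemma koszul_diff_koszul_diff:
  assumes "T \<in> cech_index n p" "y \<in> cech_index n (p - 1 - 1) \<rightarrow> carrier M"
  shows "koszul_diff M N (koszul_diff M N y) T = \<zero>"
proof -
  note T = cech_indexD(1,2)[OF assms(1)]
  let ?s = "\<lambda>T j. (-1) ^ card {l \<in> T. l < j} :: 'k mpoly"
  let ?X = "\<lambda>j. monom (Poly_Mapping.single j N) :: 'k mpoly"
  define g where "g = (\<lambda>j k. ?s T j \<odot> (?s (T - {j}) k \<odot> (?X j \<odot> (?X k \<odot> y (T - {j} - {k})))))"
  have y: "y (T - {j} - {k}) \<in> carrier M" if "j \<in> T" "k \<in> T" "j \<noteq> k" for j k
    using cech_index_remove'[of "T - {j}" n "p - 1" k] cech_index_remove'[OF assms(1), of j]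
      funcset_mem[OF assms(2)] that by auto
  have keys: "Poly_Mapping.keys (Poly_Mapping.single j N) \<subseteq> {..<n}" if "j \<in> T" for j
    using T that by auto
  have g: "g j k \<in> carrier M" if "j \<in> T" "k \<in> T" "j \<noteq> k" for j k
    unfolding g_def using that y keys by (intro sign_smult_closed monom_smult_closed) blast+
  have anti: "g k j = \<ominus> g j k" if jk: "j \<in> T" "k \<in> T" "j < k" for j k
  proof -
    \<comment> \<open>Removing the smaller index \<open>j\<close> lowers the position of
      \<open>k\<close> by one, whereas removing \<open>k\<close> leaves the position of
      \<open>j\<close> alone. This single extra sign is the antisymmetry.\<close>
    have "{l \<in> T. l < k} = insert j {l \<in> T - {j}. l < k}" "{l \<in> T - {k}. l < j} = {l \<in> T. l < j}"
      using jk by auto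
    then have "card {l \<in> T. l < k} = Suc (card {l \<in> T - {j}. l < k})"
      "card {l \<in> T - {k}. l < j} = card {l \<in> T. l < j}"
      using T(2) by simp_all
    moreover have "T - {k} - {j} = T - {j} - {k}"
      by blast
    moreover define z where "z = ?X j \<odot> (?X k \<odot> y (T - {j} - {k}))"
    moreover have "z \<in> carrier M" "?X k \<odot> (?X j \<odot> y (T - {j} - {k})) = z"
      using jk y[of j k] keys[of j] keys[of k] unfolding z_def by (simp_all del: keys_single add: keys_nat_add add.commute)
    ultimately show ?thesis
      unfolding g_def by (simp add: sign_smult del: power_Suc monom_smult_smult)
  qed
  have summand: "?s T j \<odot> (?X j \<odot> koszul_diff M N y (T - {j})) = (\<Oplus>k\<in>T - {j}. g j k)" if j: "j \<in> T" for j
  proof -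
    have inner: "?X j \<odot> koszul_diff M N y (T - {j}) =
      (\<Oplus>k\<in>T - {j}. ?X j \<odot> (?s (T - {j}) k \<odot> (?X k \<odot> y (T - {j} - {k}))))"
      unfolding koszul_diff_def using T j keys y
      by (intro finsum_smult_ldistr) (auto simp: monom_carrier simp del: keys_single)
    have "?s T j \<odot> (?X j \<odot> koszul_diff M N y (T - {j})) =
      (\<Oplus>k\<in>T - {j}. ?s T j \<odot> (?X j \<odot> (?s (T - {j}) k \<odot> (?X k \<odot> y (T - {j} - {k})))))"
      unfolding inner using T j keys y
      by (intro finsum_smult_ldistr) (auto simp: sign_carrier simp del: keys_single)
    also have "\<dots> = (\<Oplus>k\<in>T - {j}. g j k)"
      unfolding g_def using j keys y
      by (intro finsum_cong') (auto simp: monom_sign_smult simp del: keys_single monom_smult_smult)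
    finally show ?thesis .
  qed
  have "koszul_diff M N (koszul_diff M N y) T = (\<Oplus>j\<in>T. \<Oplus>k\<in>T - {j}. g j k)"
    unfolding koszul_diff_def[of M N "koszul_diff M N y"]
    using summand g by (intro finsum_cong') (auto intro!: finsum_closed)
  also have "\<dots> = \<zero>"
  proof (rule finsum_antisymmetric)
    fix j k assume jk: "j \<in> T" "k \<in> T" "j \<noteq> k"
    then show "g k j = \<ominus> g j k"
      using anti[of j k] anti[of k j] g by (cases j k rule: linorder_cases) auto
  qed (use T g in auto)
  finally show ?thesis .
qed

text \<open>The bridge between the two complexes: on cochains with common exponent \<open>N\<close>,
  the Cech differential is the Koszul differential of the numerators, with the same
  exponent.\<close>

lemma cech_diff_frac:
  assumes "\<forall>S\<in>cech_index n p. x S \<in> carrier M \<and> c S = frac M S (x S, var_power S N)"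
  shows "cech_diff n M p c = (\<lambda>T\<in>cech_index n (p + 1). frac M T (koszul_diff M N x T, var_power T N))"
  unfolding cech_diff_def
proof (rule restrict_ext)
  fix T assume T: "T \<in> cech_index n (p + 1)"
  note T' = cech_indexD(1,2)[OF T]
  interpret T: localized n M T
    using T' by unfold_locales
  interpret TG: abelian_group "localization M T"
    by (rule T.localization_group)
  let ?s = "\<lambda>j. (-1) ^ card {l \<in> T. l < j} :: 'k mpoly"
  let ?X = "\<lambda>j. monom (Poly_Mapping.single j N) :: 'k mpoly"
  have *: "?s j \<odot>\<^bsub>localization M T\<^esub> localization_map M T (c (T - {j})) =
      frac M T (?s j \<odot> (?X j \<odot> x (T - {j})), var_power T N)"
    and carr: "?X j \<odot> x (T - {j}) \<in> carrier M" if j: "j \<in> T" for j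
  proof -
    note x = bspec[OF assms cech_index_remove[OF T j]]
    have k: "Poly_Mapping.keys (var_power (T - {j}) N) \<subseteq> T - {j}" "Poly_Mapping.keys (var_power T N) \<subseteq> T"
      "Poly_Mapping.keys (Poly_Mapping.single j N) \<subseteq> T"
      using T' keys_var_power j by auto
    then have k': "Poly_Mapping.keys (var_power (T - {j}) N) \<subseteq> T"
      by blast
    show X: "?X j \<odot> x (T - {j}) \<in> carrier M"
      using T.keys_n[OF k(3)] x by (intro monom_smult_closed) auto
    have "localization_map M T (c (T - {j})) = frac M T (x (T - {j}), var_power (T - {j}) N)"
      using x k by (simp add: T.localization_map_frac)
    \<comment> \<open>Expanding by $X_j^N$ brings the fraction coming from \<open>T - {j}\<close> to
      the denominator belonging to \<open>T\<close>.\<close>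
    also have "\<dots> = frac M T (?X j \<odot> x (T - {j}), var_power T N)"
      using x k k' T' j T.frac_cancel[of "x (T - {j})" "var_power (T - {j}) N" "Poly_Mapping.single j N"]
      by (simp add: var_power_remove[of T j N] add.commute)
    finally show "?s j \<odot>\<^bsub>localization M T\<^esub> localization_map M T (c (T - {j})) =
      frac M T (?s j \<odot> (?X j \<odot> x (T - {j})), var_power T N)"
      using X k by (simp add: T.frac_smult sign_carrier)
  qed
  have keys: "Poly_Mapping.keys (var_power T N) \<subseteq> T"
    using T' by (simp add: keys_var_power)
  have "(\<Oplus>\<^bsub>localization M T\<^esub>j\<in>T. ?s j \<odot>\<^bsub>localization M T\<^esub> localization_map M T (c (T - {j}))) =
     (\<Oplus>\<^bsub>localization M T\<^esub>j\<in>T. frac M T (?s j \<odot> (?X j \<odot> x (T - {j})), var_power T N))"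
    using * carr keys by (intro TG.finsum_cong') (auto intro!: T.frac_closed)
  also have "\<dots> = frac M T (koszul_diff M N x T, var_power T N)"
    unfolding koszul_diff_def using carr keys T' by (intro T.frac_finsum) auto
  finally show "(\<Oplus>\<^bsub>localization M T\<^esub>j\<in>T. ?s j \<odot>\<^bsub>localization M T\<^esub> localization_map M T (c (T - {j}))) =
     frac M T (koszul_diff M N x T, var_power T N)" .
qed

lemma localized_cech_index: "S \<in> cech_index n p \<Longrightarrow> localized n M S"
  using cech_indexD(1) by (unfold_locales) auto

lemma cech_group: "abelian_group (cech n M p)"
proof (rule abelian_groupI)
  note G = localized.localization_group[OF localized_cech_index]
  note closed = abelian_groupE(1)[OF G] and zero = abelian_groupE(2)[OF G]
  show "\<zero>\<^bsub>cech n M p\<^esub> \<in> carrier (cech n M p)"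
    by (auto simp: cech_def intro: zero)
  fix a b c
  assume a: "a \<in> carrier (cech n M p)"
  have a': "a S \<in> carrier (localization M S)" if "S \<in> cech_index n p" for S
    using a that by (auto simp: cech_def)
  show "\<zero>\<^bsub>cech n M p\<^esub> \<oplus>\<^bsub>cech n M p\<^esub> a = a"
    using a a' by (auto simp: cech_def abelian_groupE(5)[OF G] intro!: PiE_ext[of _ "cech_index n p"])
  show "\<exists>y\<in>carrier (cech n M p). y \<oplus>\<^bsub>cech n M p\<^esub> a = \<zero>\<^bsub>cech n M p\<^esub>"
    by (rule bexI[of _ "\<lambda>S\<in>cech_index n p. \<ominus>\<^bsub>localization M S\<^esub> a S"])
      (auto simp: cech_def abelian_group.l_neg[OF G] a' intro!: abelian_group.a_inv_closed[OF G] restrict_ext)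
  assume b: "b \<in> carrier (cech n M p)"
  have b': "b S \<in> carrier (localization M S)" if "S \<in> cech_index n p" for S
    using b that by (auto simp: cech_def)
  show "a \<oplus>\<^bsub>cech n M p\<^esub> b \<in> carrier (cech n M p)"
    using a' b' by (auto simp: cech_def intro: closed)
  show "a \<oplus>\<^bsub>cech n M p\<^esub> b = b \<oplus>\<^bsub>cech n M p\<^esub> a"
    using a' b' by (auto simp: cech_def abelian_groupE(4)[OF G] intro!: restrict_ext)
  assume c: "c \<in> carrier (cech n M p)"
  have c': "c S \<in> carrier (localization M S)" if "S \<in> cech_index n p" for S
    using c that by (auto simp: cech_def)
  show "a \<oplus>\<^bsub>cech n M p\<^esub> b \<oplus>\<^bsub>cech n M p\<^esub> c = a \<oplus>\<^bsub>cech n M p\<^esub> (b \<oplus>\<^bsub>cech n M p\<^esub> c)"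
    using a' b' c' by (auto simp: cech_def abelian_groupE(3)[OF G] intro!: restrict_ext)
qed

text \<open>A statement about all large \<open>N\<close>, so that two cochains can be written with
  the same exponent, or one cochain with an exponent above a given one.\<close>

lemma cech_carrier_rep:
  assumes "c \<in> carrier (cech n M p)"
  shows "\<forall>\<^sub>F N in sequentially. \<exists>x. \<forall>S\<in>cech_index n p.
    x S \<in> carrier M \<and> c S = frac M S (x S, var_power S N)"
proof -
  have "\<forall>\<^sub>F N in sequentially. \<forall>S\<in>cech_index n p.
    \<exists>x. x \<in> carrier M \<and> c S = frac M S (x, var_power S N)"
  proof (rule eventually_ball_finite[OF finite_cech_index], rule ballI)
    fix S assume S: "S \<in> cech_index n p"
    interpret S: localized n M S
      by (rule localized_cech_index[OF S])
    have "c S \<in> carrier (localization M S)"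
      using assms S by (auto simp: cech_def)
    then obtain x e where x: "x \<in> carrier M" "Poly_Mapping.keys e \<subseteq> S" "c S = frac M S (x, e)"
      by (rule S.localization_cases)
    obtain N0 where N0: "\<And>N. N \<ge> N0 \<Longrightarrow> \<exists>f. Poly_Mapping.keys f \<subseteq> S \<and> f + e = var_power S N \<and>
      frac M S (x, e) = frac M S (monom f \<odot> x, var_power S N)"
      using S.frac_var_power_denominator[OF x(1,2)] by blast
    have "\<exists>z. z \<in> carrier M \<and> c S = frac M S (z, var_power S N)" if "N \<ge> N0" for N
      using N0[OF that] x by (metis S.keys_n monom_smult_closed)
    then show "\<forall>\<^sub>F N in sequentially. \<exists>x. x \<in> carrier M \<and> c S = frac M S (x, var_power S N)"
      unfolding eventually_sequentially by blast
  qed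
  then show ?thesis
    by (rule eventually_mono) (rule bchoice)
qed

text \<open>Finitely many index sets allow one exponent \<open>K\<close> that clears all the
  equalities at once.\<close>

lemma frac_family_eq:
  assumes "\<And>S. S \<in> cech_index n p \<Longrightarrow> x S \<in> carrier M \<and> y S \<in> carrier M \<and>
     frac M S (x S, var_power S N) = frac M S (y S, var_power S N)"
  shows "\<exists>K. \<forall>S\<in>cech_index n p. monom (var_power S K) \<odot> x S = monom (var_power S K) \<odot> y S"
proof -
  have "\<forall>\<^sub>F K in sequentially. \<forall>S\<in>cech_index n p.
    monom (var_power S K) \<odot> x S = monom (var_power S K) \<odot> y S"
  proof (rule eventually_ball_finite[OF finite_cech_index], rule ballI)
    fix S assume S: "S \<in> cech_index n p"
    interpret S: localized n M S
      by (rule localized_cech_index[OF S])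
    show "\<forall>\<^sub>F K in sequentially. monom (var_power S K) \<odot> x S = monom (var_power S K) \<odot> y S"
      using assms[OF S] S.frac_var_power_eq_iff[of "x S" "y S" N]
      unfolding eventually_sequentially by blast
  qed
  then show ?thesis
    by (auto simp: eventually_sequentially)
qed

lemma cech_rep_closed:
  assumes "\<And>S. S \<in> cech_index n p \<Longrightarrow> x S \<in> carrier M"
  shows "(\<lambda>S\<in>cech_index n p. frac M S (x S, var_power S N)) \<in> carrier (cech n M p)"
  using assms cech_indexD(2)
  by (auto simp: cech_def intro!: localized.frac_closed[OF localized_cech_index] keys_var_power)

text \<open>Zero has every exponent, so it can be compared with a cochain of any exponent
  \<open>N\<close>.\<close>

lemma cech_zero: "\<zero>\<^bsub>cech n M p\<^esub> = (\<lambda>S\<in>cech_index n p. frac M S (\<zero>, var_power S N))"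
  using cech_indexD(2)
  by (auto simp: cech_def localized.frac_zero[OF localized_cech_index] keys_var_power intro!: restrict_ext)

lemma cech_add_frac:
  assumes "\<forall>S\<in>cech_index n p. x S \<in> carrier M \<and> c S = frac M S (x S, var_power S N)"
    "\<forall>S\<in>cech_index n p. y S \<in> carrier M \<and> b S = frac M S (y S, var_power S N)"
  shows "c \<oplus>\<^bsub>cech n M p\<^esub> b = (\<lambda>S\<in>cech_index n p. frac M S (x S \<oplus> y S, var_power S N))"
  using assms cech_indexD(2)
  by (auto simp: cech_def localized.frac_add_same[OF localized_cech_index] keys_var_power intro!: restrict_ext)

text \<open>Serves to see that the boundaries of the Cech complex form a subgroup and that zero is a
  cycle, which is what the description of the graded quotient asks for.\<close>

lemma cech_diff_hom: "cech_diff n M p \<in> hom (add_monoid (cech n M p)) (add_monoid (cech n M (p + 1)))"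
proof (rule homI, unfold monoid.simps partial_object.simps)
  fix c b assume c: "c \<in> carrier (cech n M p)" and b: "b \<in> carrier (cech n M p)"
  obtain N where "(\<exists>x. \<forall>S\<in>cech_index n p. x S \<in> carrier M \<and> c S = frac M S (x S, var_power S N)) \<and>
     (\<exists>x. \<forall>S\<in>cech_index n p. x S \<in> carrier M \<and> b S = frac M S (x S, var_power S N))"
    using eventually_conj[OF cech_carrier_rep[OF c] cech_carrier_rep[OF b]]
    unfolding eventually_sequentially by blast
  then obtain x y where
    x: "\<forall>S\<in>cech_index n p. x S \<in> carrier M \<and> c S = frac M S (x S, var_power S N)" and
    y: "\<forall>S\<in>cech_index n p. y S \<in> carrier M \<and> b S = frac M S (y S, var_power S N)"
    by blast
  note dx = cech_diff_frac[OF x] and dy = cech_diff_frac[OF y]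
  have k: "koszul_diff M N z T \<in> carrier M"
    if "T \<in> cech_index n (p + 1)" "\<And>S. S \<in> cech_index n p \<Longrightarrow> z S \<in> carrier M" for z T
    using koszul_diff_closed[of T "p + 1"] that by auto
  show "cech_diff n M p c \<in> carrier (cech n M (p + 1))"
    unfolding dx using x k by (intro cech_rep_closed k) auto
  have "cech_diff n M p (c \<oplus>\<^bsub>cech n M p\<^esub> b) =
      (\<lambda>T\<in>cech_index n (p + 1). frac M T (koszul_diff M N (\<lambda>S. x S \<oplus> y S) T, var_power T N))"
    using x y by (intro cech_diff_frac) (simp add: cech_add_frac[OF x y])
  also have "\<dots> = (\<lambda>T\<in>cech_index n (p + 1).
      frac M T (koszul_diff M N x T \<oplus> koszul_diff M N y T, var_power T N))"
    using x y koszul_diff_add[of _ "p + 1" x y] by (intro restrict_ext) (simp add: Pi_def)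
  also have "\<dots> = cech_diff n M p c \<oplus>\<^bsub>cech n M (p + 1)\<^esub> cech_diff n M p b"
    using x y k by (intro cech_add_frac[symmetric]) (simp_all add: dx dy)
  finally show "cech_diff n M p (c \<oplus>\<^bsub>cech n M p\<^esub> b) =
     cech_diff n M p c \<oplus>\<^bsub>cech n M (p + 1)\<^esub> cech_diff n M p b" .
qed

end

text \<open>A generated subgroup is trivial exactly when its generators are, and a coset of
  \<open>B\<close> is zero exactly when its representative lies in \<open>B\<close>. Working
  directly with the coset operations spares the construction of the quotient as a group.\<close>

lemma grade_above_quot:
  assumes G: "abelian_group G" and B: "subgroup B (add_monoid G)"
    and Z: "\<zero>\<^bsub>G\<^esub> \<in> Z" "Z \<subseteq> carrier G"
  shows "grade_above (quot (submod G Z) B) a = {\<zero>\<^bsub>quot (submod G Z) B\<^esub>} \<longleftrightarrow>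
    (\<forall>d>a. grade G d \<inter> Z \<subseteq> B)"
proof -
  interpret G: abelian_group G by (rule G)
  interpret B: abelian_subgroup B G
    by (intro abelian_subgroupI3 additive_subgroupI B G)
  let ?H = "quot (submod G Z) B"
  have coset: "B +>\<^bsub>submod G Z\<^esub> z = B +>\<^bsub>G\<^esub> z" for z
    by (simp add: a_r_coset_def' submod_def)
  have plus: "A \<oplus>\<^bsub>?H\<^esub> A' = A <+>\<^bsub>G\<^esub> A'" for A A'
    by (simp add: quot_def set_add_def' submod_def)
  have zero: "\<zero>\<^bsub>?H\<^esub> = B"
    by (simp add: quot_def)
  have carrier: "carrier ?H = (\<lambda>z. B +>\<^bsub>G\<^esub> z) ` Z"
    unfolding quot_def by (simp add: A_RCOSETS_def' coset) (auto simp: submod_def)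
  have grade: "grade ?H d = (\<lambda>z. B +>\<^bsub>G\<^esub> z) ` (grade G d \<inter> Z)" for d
    by (simp add: quot_def coset) (simp add: submod_def)
  have BB: "B <+>\<^bsub>G\<^esub> B = B"
    by (rule G.subgroup_add_id[OF B])
  have B0: "B +>\<^bsub>G\<^esub> \<zero>\<^bsub>G\<^esub> = B"
    by (simp add: B.a_subset)
  have Bz: "B <+>\<^bsub>G\<^esub> (B +>\<^bsub>G\<^esub> z) = B +>\<^bsub>G\<^esub> z" if "z \<in> Z" for z
    using that Z G.a_setmult_rcos_assoc[of B B z] B.a_subset BB by auto
  \<comment> \<open>\<open>generate\<close> also closes under inverses, which are given by a
    definite description in the record. For the zero coset it is evaluated by hand: \<open>B\<close>
    is neutral for all cosets of elements of \<open>Z\<close>, hence its own only inverse.\<close>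
  have inv_B: "inv\<^bsub>add_monoid ?H\<^esub> B = B"
    unfolding m_inv_def
  proof (rule the_equality)
    have "B \<in> carrier ?H"
      unfolding carrier using Z(1) B0 by force
    then show "B \<in> carrier (add_monoid ?H) \<and> B \<otimes>\<^bsub>add_monoid ?H\<^esub> B = \<one>\<^bsub>add_monoid ?H\<^esub> \<and>
       B \<otimes>\<^bsub>add_monoid ?H\<^esub> B = \<one>\<^bsub>add_monoid ?H\<^esub>"
      by (simp add: plus zero BB)
  next
    fix A assume "A \<in> carrier (add_monoid ?H) \<and> B \<otimes>\<^bsub>add_monoid ?H\<^esub> A = \<one>\<^bsub>add_monoid ?H\<^esub> \<and>
       A \<otimes>\<^bsub>add_monoid ?H\<^esub> B = \<one>\<^bsub>add_monoid ?H\<^esub>"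
    then have "A \<in> carrier ?H" "B <+>\<^bsub>G\<^esub> A = B"
      by (simp_all add: plus zero)
    then show "A = B"
      using Bz by (auto simp: carrier)
  qed
  have mem: "B +>\<^bsub>G\<^esub> z = B \<longleftrightarrow> z \<in> B" if "z \<in> Z" for z
    using that Z B.a_rcos_self[of z] G.a_coset_join2[OF _ B] by auto
  show ?thesis
  proof
    assume L: "grade_above ?H a = {\<zero>\<^bsub>?H\<^esub>}"
    show "\<forall>d>a. grade G d \<inter> Z \<subseteq> B"
    proof clarify
      fix d z assume "a < d" and z: "z \<in> grade G d" "z \<in> Z"
      then have "B +>\<^bsub>G\<^esub> z \<in> (\<Union>d\<in>{a<..}. grade ?H d)"
        unfolding grade by blast
      then have "B +>\<^bsub>G\<^esub> z \<in> grade_above ?H a"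
        unfolding grade_above_def by (rule generate.incl)
      then show "z \<in> B"
        using mem z unfolding L zero by simp
    qed
  next
    assume R: "\<forall>d>a. grade G d \<inter> Z \<subseteq> B"
    have U: "A = B" if "A \<in> (\<Union>d\<in>{a<..}. grade ?H d)" for A
      using that R mem unfolding grade by auto
    have "A = B" if "A \<in> generate (add_monoid ?H) (\<Union>d\<in>{a<..}. grade ?H d)" for A
      using that
    proof induction
      case (incl h)
      then show ?case by (rule U)
    next
      case (inv h)
      then show ?case
        using U[of h] inv_B by simp
    qed (simp_all add: zero plus BB)
    then show "grade_above ?H a = {\<zero>\<^bsub>?H\<^esub>}"
      unfolding grade_above_def zero using generate.one[of "add_monoid ?H"] zero by fastforce
  qed
qed

text \<open>A weak form of grading, enough to translate local cohomology into
  \<open>lc_vanish\<close>. It passes to homology modules without a proof that these decompose into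
  homogeneous components.\<close>

locale mpoly_module_grading = mpoly_module +
  assumes grade_carrier: "x \<in> grade M d \<Longrightarrow> x \<in> carrier M"
    and grade_monom: "Poly_Mapping.keys t \<subseteq> {..<n} \<Longrightarrow> x \<in> grade M d \<Longrightarrow>
      monom t \<odot> x \<in> grade M (d + int (monom_degree t))"
begin

lemma grade_var_power:
  "S \<in> cech_index n p \<Longrightarrow> x \<in> grade M (d + int N * p) \<Longrightarrow>
    monom (var_power S K) \<odot> x \<in> grade M (d + int (N + K) * p)"
  using grade_monom[of "var_power S K" x "d + int N * p"] keys_var_power_n[of S p K] cech_indexD(2,3)[of S n p]
  by (simp add: monom_degree_var_power algebra_simps)

text \<open>A set \<open>S\<close> in cohomological index \<open>p\<close> has \<open>p\<close>
  elements, so the denominator \<open>var_power S N\<close> has degree \<open>N * p\<close>. A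
  fraction of degree \<open>d\<close> therefore has a numerator of degree
  \<open>d + N * p\<close>.\<close>

lemma cech_grade_rep:
  assumes "c \<in> grade (cech n M p) d"
  shows "\<exists>N x. \<forall>S\<in>cech_index n p. x S \<in> grade M (d + int N * p) \<and> c S = frac M S (x S, var_power S N)"
proof -
  have "\<forall>\<^sub>F N in sequentially. \<forall>S\<in>cech_index n p.
    \<exists>x. x \<in> grade M (d + int N * p) \<and> c S = frac M S (x, var_power S N)"
  proof (rule eventually_ball_finite[OF finite_cech_index], rule ballI)
    fix S assume S: "S \<in> cech_index n p"
    interpret S: localized n M S
      by (rule localized_cech_index[OF S])
    have "c S \<in> grade (localization M S) d"
      using assms S by (auto simp: cech_def)
    then obtain x e where x: "x \<in> grade M (d + int (monom_degree e))" "Poly_Mapping.keys e \<subseteq> S" "c S = frac M S (x, e)"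
      by (auto simp: localization_def)
    obtain N0 where N0: "\<And>N. N \<ge> N0 \<Longrightarrow> \<exists>f. Poly_Mapping.keys f \<subseteq> S \<and> f + e = var_power S N \<and>
      frac M S (x, e) = frac M S (monom f \<odot> x, var_power S N)"
      using S.frac_var_power_denominator[OF grade_carrier[OF x(1)] x(2)] by blast
    have "\<exists>z. z \<in> grade M (d + int N * p) \<and> c S = frac M S (z, var_power S N)" if le: "N \<ge> N0" for N
    proof -
      obtain f where f: "Poly_Mapping.keys f \<subseteq> S" "f + e = var_power S N"
        "frac M S (x, e) = frac M S (monom f \<odot> x, var_power S N)"
        using N0[OF le] by blast
      \<comment> \<open>The expanding monomial makes up exactly the difference between the old and
        the new denominator degree.\<close>
      have "int (monom_degree f) + int (monom_degree e) = int N * p"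
        using cech_indexD(2,3)[OF S] arg_cong[OF f(2), of monom_degree]
        by (simp add: monom_degree_add monom_degree_var_power flip: of_nat_add)
      then show ?thesis
        using grade_monom[of f x "d + int (monom_degree e)"] f x S.keys_n by (auto simp: add_ac)
    qed
    then show "\<forall>\<^sub>F N in sequentially. \<exists>x. x \<in> grade M (d + int N * p) \<and> c S = frac M S (x, var_power S N)"
      unfolding eventually_sequentially by blast
  qed
  then have "\<exists>N. \<forall>S\<in>cech_index n p. \<exists>x. x \<in> grade M (d + int N * p) \<and> c S = frac M S (x, var_power S N)"
    unfolding eventually_sequentially by blast
  then show ?thesis
    using bchoice[of "cech_index n p"] by metis
qed

lemma cech_rep_grade:
  assumes "\<And>S. S \<in> cech_index n p \<Longrightarrow> x S \<in> grade M (d + int N * p)"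
  shows "(\<lambda>S\<in>cech_index n p. frac M S (x S, var_power S N)) \<in> grade (cech n M p) d"
proof -
  have "frac M S (x S, var_power S N) \<in> grade (localization M S) d" if S: "S \<in> cech_index n p" for S
  proof -
    have "x S \<in> grade M (d + int (monom_degree (var_power S N)))"
      using assms[OF S] cech_indexD(2,3)[OF S] by (simp add: monom_degree_var_power)
    then show ?thesis
      using keys_var_power[OF cech_indexD(2)[OF S]] by (auto simp: localization_def)
  qed
  then show ?thesis
    by (simp add: cech_def)
qed

text \<open>A homogeneous Cech cocycle becomes a homogeneous Koszul cocycle at a high enough level.
  The Koszul cochain that bounds it there, read as a family of numerators, bounds the original
  cocycle.\<close>

lemma lc_vanish_imp_exact:
  assumes V: "lc_vanish n M p d" and c: "c \<in> grade (cech n M p) d"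
    and dc: "cech_diff n M p c = \<zero>\<^bsub>cech n M (p + 1)\<^esub>"
  shows "c \<in> cech_diff n M (p - 1) ` carrier (cech n M (p - 1))"
proof -
  obtain N0 x0 where x0: "\<And>S. S \<in> cech_index n p \<Longrightarrow>
      x0 S \<in> grade M (d + int N0 * p) \<and> c S = frac M S (x0 S, var_power S N0)"
    using cech_grade_rep[OF c] by blast
  have x0': "\<forall>S\<in>cech_index n p. x0 S \<in> carrier M \<and> c S = frac M S (x0 S, var_power S N0)"
    using x0 grade_carrier by blast
  have kc: "koszul_diff M N0 x0 T \<in> carrier M" if "T \<in> cech_index n (p + 1)" for T
    using koszul_diff_closed[OF that, of x0 N0] x0' by auto
  have "frac M T (koszul_diff M N0 x0 T, var_power T N0) = frac M T (\<zero>, var_power T N0)"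
    if "T \<in> cech_index n (p + 1)" for T
    using fun_cong[OF dc[unfolded cech_diff_frac[OF x0'] cech_zero[of "p + 1" N0]], of T] that by simp
  then obtain K0 where K0: "\<And>T. T \<in> cech_index n (p + 1) \<Longrightarrow>
      monom (var_power T K0) \<odot> koszul_diff M N0 x0 T = monom (var_power T K0) \<odot> \<zero>"
    using frac_family_eq[of "p + 1" "koszul_diff M N0 x0" "\<lambda>_. \<zero>" N0] kc by blast
  \<comment> \<open>The differential of the numerators \<open>x0\<close> vanishes only as a
    fraction. Passing to level \<open>N0 + K0\<close> makes it vanish in \<open>M\<close>.\<close>
  define x where "x = (\<lambda>S. monom (var_power S K0) \<odot> x0 S)"
  define N where "N = N0 + K0"
  have x: "x S \<in> grade M (d + int N * p)" if "S \<in> cech_index n p" for S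
    unfolding x_def N_def using x0 that by (intro grade_var_power) auto
  have cS: "c S = frac M S (x S, var_power S N)" if S: "S \<in> cech_index n p" for S
  proof -
    interpret S: localized n M S
      by (rule localized_cech_index[OF S])
    show ?thesis
      using bspec[OF x0' S] S.frac_cancel[of "x0 S" "var_power S N0" "var_power S K0"] cech_indexD(2)[OF S]
      by (simp add: x_def N_def keys_var_power var_power_add add.commute)
  qed
  have dx: "koszul_diff M N x T = \<zero>" if T: "T \<in> cech_index n (p + 1)" for T
    using koszul_diff_scale[OF T, of x0 K0 N0] x0' K0[OF T] keys_var_power_n[OF T]
    by (simp add: x_def N_def monom_carrier Pi_def)
  obtain K y where y: "\<forall>S\<in>cech_index n (p - 1). y S \<in> carrier M"
    and xy: "\<forall>T\<in>cech_index n p. monom (var_power T K) \<odot> x T = koszul_diff M (N + K) y T"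
    by (rule lc_vanishE[OF V, of x N]) (use x dx in blast)+
  let ?b = "\<lambda>S\<in>cech_index n (p - 1). frac M S (y S, var_power S (N + K))"
  have "cech_diff n M (p - 1) ?b =
      (\<lambda>T\<in>cech_index n (p - 1 + 1). frac M T (koszul_diff M (N + K) y T, var_power T (N + K)))"
    using y by (intro cech_diff_frac) auto
  also have "\<dots> = c"
  proof (rule extensionalityI[of _ "cech_index n p"])
    show "c \<in> extensional (cech_index n p)"
      using c by (auto simp: cech_def PiE_def)
    fix T assume T: "T \<in> cech_index n p"
    interpret T: localized n M T
      by (rule localized_cech_index[OF T])
    show "(\<lambda>T\<in>cech_index n (p - 1 + 1). frac M T (koszul_diff M (N + K) y T, var_power T (N + K))) T = c T"
      using T bspec[OF xy T] cS[OF T] grade_carrier[OF x[OF T]] cech_indexD(2)[OF T]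
        T.frac_cancel[of "x T" "var_power T N" "var_power T K"]
      by (simp add: keys_var_power var_power_add add.commute)
  qed simp
  finally have "c = cech_diff n M (p - 1) ?b"
    by (rule sym)
  moreover have "?b \<in> carrier (cech n M (p - 1))"
    using y by (intro cech_rep_closed) blast
  ultimately show ?thesis
    by (rule image_eqI)
qed

text \<open>A Koszul cocycle gives a Cech cocycle. If the latter is a boundary, clearing
  denominators shows that the former bounds at a later level.\<close>

lemma exact_imp_lc_vanish:
  assumes E: "\<And>c. c \<in> grade (cech n M p) d \<Longrightarrow> c \<in> carrier (cech n M p) \<Longrightarrow>
      cech_diff n M p c = \<zero>\<^bsub>cech n M (p + 1)\<^esub> \<Longrightarrow>
      c \<in> cech_diff n M (p - 1) ` carrier (cech n M (p - 1))"
  shows "lc_vanish n M p d"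
  unfolding lc_vanish_def
proof clarify
  fix N x
  assume x: "\<forall>S\<in>cech_index n p. x S \<in> grade M (d + int N * p)"
    and dx: "\<forall>T\<in>cech_index n (p + 1). koszul_diff M N x T = \<zero>"
  have x': "x S \<in> carrier M" if "S \<in> cech_index n p" for S
    using x that grade_carrier by blast
  let ?c = "\<lambda>S\<in>cech_index n p. frac M S (x S, var_power S N)"
  have "cech_diff n M p ?c = (\<lambda>T\<in>cech_index n (p + 1). frac M T (koszul_diff M N x T, var_power T N))"
    using x' by (intro cech_diff_frac) auto
  also have "\<dots> = \<zero>\<^bsub>cech n M (p + 1)\<^esub>"
    unfolding cech_zero[of _ N] using dx by (intro restrict_ext) auto
  finally have "?c \<in> cech_diff n M (p - 1) ` carrier (cech n M (p - 1))"
    using x x' by (intro E cech_rep_grade cech_rep_closed) auto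
  then obtain b where b: "b \<in> carrier (cech n M (p - 1))" "?c = cech_diff n M (p - 1) b"
    by blast
  obtain N1 where "\<And>N'. N' \<ge> N1 \<Longrightarrow> \<exists>y. \<forall>S\<in>cech_index n (p - 1).
      y S \<in> carrier M \<and> b S = frac M S (y S, var_power S N')"
    using cech_carrier_rep[OF b(1)] unfolding eventually_sequentially by blast
  \<comment> \<open>The exponent \<open>N + N1\<close> is large enough to represent \<open>b\<close>
    and is also a later level than \<open>N\<close>, so that \<open>x\<close> can be moved to it by
    the transition map.\<close>
  then obtain y where y: "\<forall>S\<in>cech_index n (p - 1).
      y S \<in> carrier M \<and> b S = frac M S (y S, var_power S (N + N1))"
    using le_add2[of N1 N] by blast
  have yc: "koszul_diff M (N + N1) y T \<in> carrier M" if T: "T \<in> cech_index n p" for T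
    using koszul_diff_closed[OF T] y by auto
  have "frac M T (koszul_diff M (N + N1) y T, var_power T (N + N1)) =
      frac M T (monom (var_power T N1) \<odot> x T, var_power T (N + N1))" if T: "T \<in> cech_index n p" for T
  proof -
    interpret T: localized n M T
      by (rule localized_cech_index[OF T])
    have "frac M T (x T, var_power T N) = frac M T (koszul_diff M (N + N1) y T, var_power T (N + N1))"
      using fun_cong[OF b(2)[unfolded cech_diff_frac[OF y]], of T] T by simp
    then show ?thesis
      using T.frac_cancel[of "x T" "var_power T N" "var_power T N1"] x'[OF T] cech_indexD(2)[OF T]
      by (simp add: keys_var_power var_power_add add.commute)
  qed
  \<comment> \<open>At level \<open>N + N1\<close> the two sides agree only as fractions. A further
    shift by \<open>K\<close> makes them agree in \<open>M\<close>, so the total shift is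
    \<open>N1 + K\<close>.\<close>
  then obtain K where K: "\<And>T. T \<in> cech_index n p \<Longrightarrow>
      monom (var_power T K) \<odot> koszul_diff M (N + N1) y T =
      monom (var_power T K) \<odot> (monom (var_power T N1) \<odot> x T)"
    using frac_family_eq[of p "koszul_diff M (N + N1) y" "\<lambda>T. monom (var_power T N1) \<odot> x T" "N + N1"]
      yc x' keys_var_power_n by (metis monom_smult_closed)
  show "\<exists>K y. (\<forall>S\<in>cech_index n (p - 1). y S \<in> carrier M) \<and>
        (\<forall>T\<in>cech_index n p. monom (var_power T K) \<odot> x T = koszul_diff M (N + K) y T)"
  proof (intro exI conjI ballI)
    show "monom (var_power S K) \<odot> y S \<in> carrier M" if "S \<in> cech_index n (p - 1)" for S
      using bspec[OF y that] keys_var_power_n[OF that] by simp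
    fix T assume T: "T \<in> cech_index n p"
    have "koszul_diff M (N + N1 + K) (\<lambda>S. monom (var_power S K) \<odot> y S) T =
        monom (var_power T K) \<odot> koszul_diff M (N + N1) y T"
      using y by (intro koszul_diff_scale[OF T, symmetric]) auto
    also have "\<dots> = monom (var_power T (N1 + K)) \<odot> x T"
      using K[OF T] x'[OF T] keys_var_power_n[OF T] by (simp add: var_power_add add.commute)
    finally show "monom (var_power T (N1 + K)) \<odot> x T =
        koszul_diff M (N + (N1 + K)) (\<lambda>S. monom (var_power S K) \<odot> y S) T"
      by (simp add: add.assoc)
  qed
qed

lemma local_cohomology_vanishing:
  "grade_above (local_cohomology n i M) a = {\<zero>\<^bsub>local_cohomology n i M\<^esub>} \<longleftrightarrow>
    (\<forall>d>a. lc_vanish n M (int i) d)"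
proof -
  let ?p = "int i"
  let ?Z = "{c \<in> carrier (cech n M ?p). cech_diff n M ?p c = \<zero>\<^bsub>cech n M (?p + 1)\<^esub>}"
  let ?B = "cech_diff n M (?p - 1) ` carrier (cech n M (?p - 1))"
  \<comment> \<open>The Cech complex enters \<open>homology\<close> with negated degrees, so the
    boundaries come from cohomological index \<open>p - 1\<close> and the cycles map to
    \<open>p + 1\<close>.\<close>
  have H: "local_cohomology n i M = quot (submod (cech n M ?p) ?Z) ?B"
    by (simp add: local_cohomology_def homology_def cycles_def boundaries_def submod_def add.commute)
  interpret G: abelian_group "cech n M q" for q
    by (rule cech_group)
  have hom: "group_hom (add_monoid (cech n M q)) (add_monoid (cech n M (q + 1))) (cech_diff n M q)" for q
    using cech_diff_hom[of q] by (simp add: group_hom_def group_hom_axioms_def G.a_group)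
  have B: "subgroup ?B (add_monoid (cech n M ?p))"
    using group_hom.img_is_subgroup[OF hom[of "?p - 1"]] by simp
  have Z: "\<zero>\<^bsub>cech n M ?p\<^esub> \<in> ?Z"
    using group_hom.hom_one[OF hom[of ?p]] by simp
  have "grade_above (local_cohomology n i M) a = {\<zero>\<^bsub>local_cohomology n i M\<^esub>} \<longleftrightarrow>
      (\<forall>d>a. grade (cech n M ?p) d \<inter> ?Z \<subseteq> ?B)"
    unfolding H by (rule grade_above_quot[OF cech_group B Z]) blast
  also have "\<dots> \<longleftrightarrow> (\<forall>d>a. lc_vanish n M ?p d)"
  proof (intro iffI allI impI)
    fix d assume "\<forall>d>a. grade (cech n M ?p) d \<inter> ?Z \<subseteq> ?B" "d > a"
    then show "lc_vanish n M ?p d"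
      by (intro exact_imp_lc_vanish) blast
  next
    fix d assume "\<forall>d>a. lc_vanish n M ?p d" "d > a"
    then show "grade (cech n M ?p) d \<inter> ?Z \<subseteq> ?B"
      using lc_vanish_imp_exact by blast
  qed
  finally show ?thesis .
qed

text \<open>In negative cohomological degrees \<open>lc_vanish\<close> holds vacuously, so that the truncation at \<open>0\<close>
  in \<open>shift X a\<close> disappears.\<close>

lemma regular_wrt_shift_iff:
  "regular_wrt n (shift X a) (m + a) M \<longleftrightarrow> (\<forall>i\<in>X. \<forall>d>m - int i. lc_vanish n M (int i + a) d)"
proof (intro iffI ballI allI impI)
  fix i d assume R: "regular_wrt n (shift X a) (m + a) M" and i: "i \<in> X" "m - int i < d"
  show "lc_vanish n M (int i + a) d"
  proof (cases "int i + a < 0")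
    case True
    then show ?thesis
      by (rule lc_vanish_neg)
  next
    case False
    then obtain j where j: "int j = int i + a"
      by (metis linorder_not_less zero_le_imp_eq_int)
    with i have "j \<in> shift X a"
      by (auto simp: shift_def)
    with R have "\<forall>d>m + a - int j. lc_vanish n M (int j) d"
      by (simp add: regular_wrt_def local_cohomology_vanishing)
    with i j show ?thesis
      by simp
  qed
next
  assume "\<forall>i\<in>X. \<forall>d>m - int i. lc_vanish n M (int i + a) d"
  then show "regular_wrt n (shift X a) (m + a) M"
    by (fastforce simp: regular_wrt_def local_cohomology_vanishing shift_def)
qed

end


section \<open>Short exact sequences\<close>

text \<open>Stated for additive maps because it is applied not only to module homomorphisms but also
  to projections onto homogeneous components, which are not linear over the polynomial ring.\<close>

lemma finsum_additive:
  assumes G: "abelian_group G" and H: "abelian_group H" and h: "h \<in> carrier G \<rightarrow> carrier H"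
    and add: "\<And>x y. x \<in> carrier G \<Longrightarrow> y \<in> carrier G \<Longrightarrow> h (x \<oplus>\<^bsub>G\<^esub> y) = h x \<oplus>\<^bsub>H\<^esub> h y"
    and A: "finite A" "g \<in> A \<rightarrow> carrier G"
  shows "h (\<Oplus>\<^bsub>G\<^esub>i\<in>A. g i) = (\<Oplus>\<^bsub>H\<^esub>i\<in>A. h (g i))"
proof -
  interpret G: abelian_group G by (rule G)
  interpret H: abelian_group H by (rule H)
  have "h \<zero>\<^bsub>G\<^esub> \<oplus>\<^bsub>H\<^esub> h \<zero>\<^bsub>G\<^esub> = h \<zero>\<^bsub>G\<^esub>"
    using add[of "\<zero>\<^bsub>G\<^esub>" "\<zero>\<^bsub>G\<^esub>"] by simp
  then have 0: "h \<zero>\<^bsub>G\<^esub> = \<zero>\<^bsub>H\<^esub>"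
    using h H.add.r_cancel_one[of "h \<zero>\<^bsub>G\<^esub>" "h \<zero>\<^bsub>G\<^esub>"] by auto
  show ?thesis
    using A
  proof induction
    case empty
    show ?case using 0 by simp
  next
    case (insert a A)
    have ga: "g a \<in> carrier G" and gA: "g \<in> A \<rightarrow> carrier G"
      using insert.prems by auto
    have "h (\<Oplus>\<^bsub>G\<^esub>i\<in>insert a A. g i) = h (g a \<oplus>\<^bsub>G\<^esub> (\<Oplus>\<^bsub>G\<^esub>i\<in>A. g i))"
      using insert.hyps ga gA by simp
    also have "\<dots> = h (g a) \<oplus>\<^bsub>H\<^esub> (\<Oplus>\<^bsub>H\<^esub>i\<in>A. h (g i))"
      using ga gA by (simp add: add insert.IH)
    also have "\<dots> = (\<Oplus>\<^bsub>H\<^esub>i\<in>insert a A. h (g i))"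
      using insert.hyps ga gA h by (intro H.finsum_insert[symmetric]) auto
    finally show ?case .
  qed
qed

lemma (in abelian_group) finsum_subgroup:
  assumes "subgroup H (add_monoid G)" "finite A" "g \<in> A \<rightarrow> H"
  shows "(\<Oplus>i\<in>A. g i) \<in> H"
  using assms(2,3)
proof induction
  case empty
  show ?case
    using subgroup.one_closed[OF assms(1)] by simp
next
  case (insert a A)
  have "H \<subseteq> carrier G"
    using subgroup.subset[OF assms(1)] by simp
  then show ?case
    using insert subgroup.m_closed[OF assms(1), of "g a" "\<Oplus>i\<in>A. g i"]
    by (subst finsum_insert) auto
qed

text \<open>Linearity without a condition on degrees. Where degrees matter,
  \<open>graded_exact\<close> states separately, and more strongly, that homogeneous pieces map onto
  homogeneous pieces.\<close>

definition mpoly_hom ::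
  "nat \<Rightarrow> ('k::field mpoly, 'b) graded_module \<Rightarrow> ('k mpoly, 'c) graded_module \<Rightarrow> ('b \<Rightarrow> 'c) set"
  where
  "mpoly_hom n M N =
     {f \<in> carrier M \<rightarrow> carrier N.
        (\<forall>x\<in>carrier M. \<forall>y\<in>carrier M. f (x \<oplus>\<^bsub>M\<^esub> y) = f x \<oplus>\<^bsub>N\<^esub> f y) \<and>
        (\<forall>r\<in>carrier (mpoly_ring n). \<forall>x\<in>carrier M. f (r \<odot>\<^bsub>M\<^esub> x) = r \<odot>\<^bsub>N\<^esub> f x)}"

lemma mpoly_homD:
  assumes "f \<in> mpoly_hom n M N"
  shows "f \<in> carrier M \<rightarrow> carrier N"
    "x \<in> carrier M \<Longrightarrow> f x \<in> carrier N"
    "x \<in> carrier M \<Longrightarrow> y \<in> carrier M \<Longrightarrow> f (x \<oplus>\<^bsub>M\<^esub> y) = f x \<oplus>\<^bsub>N\<^esub> f y"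
    "r \<in> carrier (mpoly_ring n) \<Longrightarrow> x \<in> carrier M \<Longrightarrow> f (r \<odot>\<^bsub>M\<^esub> x) = r \<odot>\<^bsub>N\<^esub> f x"
  using assms by (auto simp: mpoly_hom_def)

locale mpoly_module_hom = M: mpoly_module n M + N: mpoly_module n N
  for n :: nat and M :: "('k::field mpoly, 'b) graded_module"
    and N :: "('k mpoly, 'c) graded_module" +
  fixes f :: "'b \<Rightarrow> 'c"
  assumes hom: "f \<in> mpoly_hom n M N"
begin

lemmas f_closed [simp] = mpoly_homD(2)[OF hom]
  and f_add = mpoly_homD(3)[OF hom]
  and f_smult = mpoly_homD(4)[OF hom]

lemma f_monom:
  "Poly_Mapping.keys t \<subseteq> {..<n} \<Longrightarrow> x \<in> carrier M \<Longrightarrow> f (monom t \<odot>\<^bsub>M\<^esub> x) = monom t \<odot>\<^bsub>N\<^esub> f x"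
  by (simp add: f_smult M.monom_carrier)

lemma f_zero: "f \<zero>\<^bsub>M\<^esub> = \<zero>\<^bsub>N\<^esub>"
  using f_add[of "\<zero>\<^bsub>M\<^esub>" "\<zero>\<^bsub>M\<^esub>"] N.add.r_cancel_one[of "f \<zero>\<^bsub>M\<^esub>" "f \<zero>\<^bsub>M\<^esub>"] by simp

lemma f_minus: "x \<in> carrier M \<Longrightarrow> f (\<ominus>\<^bsub>M\<^esub> x) = \<ominus>\<^bsub>N\<^esub> f x"
  using f_add[of "\<ominus>\<^bsub>M\<^esub> x" x] by (intro N.minus_equality[symmetric]) (auto simp: M.l_neg f_zero)

lemma f_koszul_diff:
  assumes T: "T \<in> cech_index n p" and y: "y \<in> cech_index n (p - 1) \<rightarrow> carrier M"
  shows "f (koszul_diff M K y T) = koszul_diff N K (\<lambda>S. f (y S)) T"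
proof -
  have fy: "(\<lambda>S. f (y S)) \<in> cech_index n (p - 1) \<rightarrow> carrier N"
    using funcset_mem[OF y] by auto
  have "f (koszul_diff M K y T) = (\<Oplus>\<^bsub>N\<^esub>j\<in>T. f ((-1) ^ card {l \<in> T. l < j} \<odot>\<^bsub>M\<^esub>
     (monom (Poly_Mapping.single j K) \<odot>\<^bsub>M\<^esub> y (T - {j}))))"
    unfolding koszul_diff_def
    using M.koszul_term_closed[OF T y] cech_indexD(2)[OF T] mpoly_homD(1)[OF hom]
    by (intro finsum_additive f_add M.abelian_group_axioms N.abelian_group_axioms) auto
  also have "\<dots> = koszul_diff N K (\<lambda>S. f (y S)) T"
    unfolding koszul_diff_def
  proof (rule N.finsum_cong')
    fix j assume j: "j \<in> T"
    have "y (T - {j}) \<in> carrier M" "Poly_Mapping.keys (Poly_Mapping.single j K) \<subseteq> {..<n}"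
      using funcset_mem[OF y] cech_index_remove'[OF T j] cech_indexD(1)[OF T] j by auto
    then show "f ((-1) ^ card {l \<in> T. l < j} \<odot>\<^bsub>M\<^esub> (monom (Poly_Mapping.single j K) \<odot>\<^bsub>M\<^esub> y (T - {j}))) =
        (-1) ^ card {l \<in> T. l < j} \<odot>\<^bsub>N\<^esub> (monom (Poly_Mapping.single j K) \<odot>\<^bsub>N\<^esub> f (y (T - {j})))"
      by (simp add: f_smult M.sign_carrier f_monom del: keys_single)
  qed (use N.koszul_term_closed[OF T fy] in auto)
  finally show ?thesis .
qed

end

context mpoly_module
begin

lemma minus_hom: "(\<lambda>x. \<ominus> x) \<in> mpoly_hom n M M"
  by (auto simp: mpoly_hom_def minus_add smult_r_minus)

text \<open>Negation is itself a module homomorphism, so this is an instance of homomorphisms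
  commuting with the Koszul differential.\<close>

lemma koszul_diff_minus:
  assumes "T \<in> cech_index n p" "y \<in> cech_index n (p - 1) \<rightarrow> carrier M"
  shows "koszul_diff M N (\<lambda>S. \<ominus> y S) T = \<ominus> koszul_diff M N y T"
proof -
  interpret mpoly_module_hom n M M "\<lambda>x. \<ominus> x"
    by unfold_locales (rule minus_hom)
  show ?thesis
    using f_koszul_diff[OF assms] by simp
qed

lemma koszul_diff_diff:
  assumes "T \<in> cech_index n p" "y \<in> cech_index n (p - 1) \<rightarrow> carrier M"
    "z \<in> cech_index n (p - 1) \<rightarrow> carrier M"
  shows "koszul_diff M N (\<lambda>S. y S \<ominus> z S) T = koszul_diff M N y T \<ominus> koszul_diff M N z T"
  using koszul_diff_add[OF assms(1,2), of "\<lambda>S. \<ominus> z S" N] koszul_diff_minus[OF assms(1,3)] assms(3)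
  by (simp add: a_minus_def Pi_def)

end

text \<open>The projections are a parameter, so that a submodule stable under them inherits the very
  same maps. In particular the cycles use the projections of the ambient module.\<close>

locale graded_projections = mpoly_module_grading +
  fixes \<pi> :: "int \<Rightarrow> 'b \<Rightarrow> 'b"
  assumes grade_subgroup: "subgroup (grade M d) (add_monoid M)"
    and proj_grade: "x \<in> carrier M \<Longrightarrow> \<pi> d x \<in> grade M d"
    and proj_add: "x \<in> carrier M \<Longrightarrow> y \<in> carrier M \<Longrightarrow> \<pi> d (x \<oplus> y) = \<pi> d x \<oplus> \<pi> d y"
    and proj_id: "x \<in> grade M d \<Longrightarrow> \<pi> d x = x"
    and proj_monom: "Poly_Mapping.keys t \<subseteq> {..<n} \<Longrightarrow> x \<in> carrier M \<Longrightarrow>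
      \<pi> (d + int (monom_degree t)) (monom t \<odot> x) = monom t \<odot> \<pi> d x"
begin

lemma grade_minus: "x \<in> grade M d \<Longrightarrow> \<ominus> x \<in> grade M d"
  using subgroup.m_inv_closed[OF grade_subgroup] by (simp add: a_inv_def)

lemma grade_diff: "x \<in> grade M d \<Longrightarrow> y \<in> grade M d \<Longrightarrow> x \<ominus> y \<in> grade M d"
  using subgroup.m_closed[OF grade_subgroup] grade_minus by (simp add: a_minus_def)

lemma proj_closed: "x \<in> carrier M \<Longrightarrow> \<pi> d x \<in> carrier M"
  using proj_grade grade_carrier by blast

lemma proj_minus: "x \<in> carrier M \<Longrightarrow> \<pi> d (\<ominus> x) = \<ominus> \<pi> d x"
proof -
  assume x: "x \<in> carrier M"
  have "\<pi> d (\<ominus> x) \<oplus> \<pi> d x = \<zero>"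
    using proj_add[of "\<ominus> x" x d] x proj_id[of \<zero> d] subgroup.one_closed[OF grade_subgroup] by (simp add: l_neg)
  then show ?thesis
    using x proj_closed by (intro minus_equality[symmetric]) auto
qed

lemma proj_diff: "x \<in> carrier M \<Longrightarrow> y \<in> carrier M \<Longrightarrow> \<pi> d (x \<ominus> y) = \<pi> d x \<ominus> \<pi> d y"
  by (simp add: a_minus_def proj_add proj_minus)

lemma koszul_term_grade:
  assumes "T \<in> cech_index n p" "\<forall>S\<in>cech_index n (p - 1). y S \<in> grade M (d + int N * (p - 1))" "j \<in> T"
  shows "(-1) ^ k \<odot> (monom (Poly_Mapping.single j N) \<odot> y (T - {j})) \<in> grade M (d + int N * p)"
proof -
  have "monom (Poly_Mapping.single j N) \<odot> y (T - {j}) \<in> grade M (d + int N * (p - 1) + int (monom_degree (Poly_Mapping.single j N)))"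
    using assms cech_index_remove'[OF assms(1,3)] cech_indexD(1)[OF assms(1)]
    by (intro grade_monom) auto
  then have "monom (Poly_Mapping.single j N) \<odot> y (T - {j}) \<in> grade M (d + int N * p)"
    by (simp add: monom_degree_single algebra_simps)
  then show ?thesis
    using grade_carrier grade_minus by (simp add: sign_smult)
qed

lemma koszul_diff_grade:
  assumes "T \<in> cech_index n p" "\<forall>S\<in>cech_index n (p - 1). y S \<in> grade M (d + int N * (p - 1))"
  shows "koszul_diff M N y T \<in> grade M (d + int N * p)"
  unfolding koszul_diff_def
  using koszul_term_grade[OF assms] cech_indexD(2)[OF assms(1)]
  by (intro finsum_subgroup grade_subgroup) auto

lemma proj_sign: "x \<in> carrier M \<Longrightarrow> \<pi> d ((-1) ^ k \<odot> x) = (-1) ^ k \<odot> \<pi> d x"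
  by (simp add: sign_smult proj_closed proj_minus)

text \<open>This makes the witnesses of \<open>lc_vanish\<close> homogeneous: if the differential of
  \<open>y\<close> is homogeneous of degree \<open>d + N * p\<close>, then the component of
  \<open>y\<close> in degree \<open>d + N * (p - 1)\<close> has the same differential.\<close>

lemma proj_koszul_diff:
  assumes T: "T \<in> cech_index n p" and y: "y \<in> cech_index n (p - 1) \<rightarrow> carrier M"
  shows "\<pi> (d + int N * p) (koszul_diff M N y T) =
    koszul_diff M N (\<lambda>S. \<pi> (d + int N * (p - 1)) (y S)) T"
proof -
  have py: "(\<lambda>S. \<pi> (d + int N * (p - 1)) (y S)) \<in> cech_index n (p - 1) \<rightarrow> carrier M"
    using y by (auto intro: proj_closed)
  have "\<pi> (d + int N * p) (koszul_diff M N y T) = (\<Oplus>j\<in>T. \<pi> (d + int N * p)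
     ((-1) ^ card {l \<in> T. l < j} \<odot> (monom (Poly_Mapping.single j N) \<odot> y (T - {j}))))"
    unfolding koszul_diff_def
    using koszul_term_closed[OF T y] cech_indexD(2)[OF T]
    by (intro finsum_additive abelian_group_axioms proj_add) (auto intro: proj_closed)
  also have "\<dots> = koszul_diff M N (\<lambda>S. \<pi> (d + int N * (p - 1)) (y S)) T"
    unfolding koszul_diff_def
  proof (rule finsum_cong')
    fix j assume j: "j \<in> T"
    have yj: "y (T - {j}) \<in> carrier M" and keys: "Poly_Mapping.keys (Poly_Mapping.single j N) \<subseteq> {..<n}"
      using funcset_mem[OF y] cech_index_remove'[OF T j] cech_indexD(1)[OF T] j by auto
    have deg: "d + int N * p = d + int N * (p - 1) + int (monom_degree (Poly_Mapping.single j N))"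
      by (simp add: monom_degree_single algebra_simps)
    show "\<pi> (d + int N * p) ((-1) ^ card {l \<in> T. l < j} \<odot> (monom (Poly_Mapping.single j N) \<odot> y (T - {j}))) =
        (-1) ^ card {l \<in> T. l < j} \<odot> (monom (Poly_Mapping.single j N) \<odot> \<pi> (d + int N * (p - 1)) (y (T - {j})))"
      unfolding deg using yj keys by (subst proj_sign) (simp_all del: keys_single add: proj_monom)
  qed (use koszul_term_closed[OF T py] in auto)
  finally show ?thesis .
qed

end

section \<open>Short exact sequences of graded modules and the vanishing of one term\<close>

lemma submod_simps [simp]:
  "carrier (submod M N) = N" "add (submod M N) = add M" "zero (submod M N) = zero M"
  "smult (submod M N) = smult M" "grade (submod M N) d = grade M d \<inter> N"
  by (simp_all add: submod_def)

locale graded_exact = M: graded_projections n M \<pi> + A: mpoly_module_grading n "submod M N"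
    + Q: mpoly_module_grading n Q + f: mpoly_module_hom n M Q f
  for n :: nat and M :: "('k::field mpoly, 'b) graded_module" and \<pi> :: "int \<Rightarrow> 'b \<Rightarrow> 'b"
    and N :: "'b set" and Q :: "('k mpoly, 'c) graded_module" and f :: "'b \<Rightarrow> 'c" +
  assumes kernel: "N = {x \<in> carrier M. f x = \<zero>\<^bsub>Q\<^esub>}"
    and proj_kernel: "x \<in> N \<Longrightarrow> \<pi> d x \<in> N"
    and f_carrier: "f ` carrier M = carrier Q"
    and f_grade: "f ` grade M d = grade Q d"
begin

lemma N_carrier: "x \<in> N \<Longrightarrow> x \<in> carrier M"
  by (simp add: kernel)

text \<open>The two finite sums are formed in different records. They agree because the inclusion is
  a homomorphism.\<close>

lemma koszul_diff_submod:
  assumes "T \<in> cech_index n p" "y \<in> cech_index n (p - 1) \<rightarrow> N"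
  shows "koszul_diff (submod M N) K y T = koszul_diff M K y T"
proof -
  interpret i: mpoly_module_hom n "submod M N" M "\<lambda>x. x"
    by unfold_locales (auto simp: mpoly_hom_def N_carrier)
  show ?thesis
    using i.f_koszul_diff[of T p y] assms by simp
qed

lemma lift_carrier:
  assumes "\<forall>S\<in>I. q S \<in> carrier Q"
  obtains y where "\<forall>S\<in>I. y S \<in> carrier M \<and> f (y S) = q S"
proof -
  have "\<forall>S\<in>I. \<exists>y. y \<in> carrier M \<and> f y = q S"
    using assms f_carrier by (metis imageE)
  then show thesis
    using that by (auto dest: bchoice)
qed

lemma lift_grade:
  assumes "\<forall>S\<in>I. q S \<in> grade Q d"
  obtains y where "\<forall>S\<in>I. y S \<in> grade M d \<and> f (y S) = q S"
proof -
  have "\<forall>S\<in>I. \<exists>y. y \<in> grade M d \<and> f y = q S"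
    using assms f_grade by (metis imageE)
  then show thesis
    using that by (auto dest: bchoice)
qed

lemma f_diff: "x \<in> carrier M \<Longrightarrow> y \<in> carrier M \<Longrightarrow> f (x \<ominus>\<^bsub>M\<^esub> y) = f x \<ominus>\<^bsub>Q\<^esub> f y"
  by (simp add: a_minus_def f.f_add f.f_minus)

text \<open>Exactness at the middle term: the image of \<open>x\<close> in \<open>Q\<close> bounds a
  cochain \<open>q\<close>. Subtracting from \<open>x\<close> the differential of a lift of
  \<open>q\<close> leaves a cocycle with values in \<open>N\<close>, which bounds there.\<close>

lemma lc_vanish_middle:
  assumes A: "lc_vanish n (submod M N) p d" and Q: "lc_vanish n Q p d"
  shows "lc_vanish n M p d"
  unfolding lc_vanish_def
proof clarify
  fix N0 x
  assume x: "\<forall>S\<in>cech_index n p. x S \<in> grade M (d + int N0 * p)"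
    and dx: "\<forall>T\<in>cech_index n (p + 1). koszul_diff M N0 x T = \<zero>\<^bsub>M\<^esub>"
  have xc: "x \<in> cech_index n p \<rightarrow> carrier M"
    using x M.grade_carrier by blast
  have fx: "\<forall>S\<in>cech_index n p. f (x S) \<in> grade Q (d + int N0 * p)"
    using x f_grade by blast
  have dfx: "\<forall>T\<in>cech_index n (p + 1). koszul_diff Q N0 (\<lambda>S. f (x S)) T = \<zero>\<^bsub>Q\<^esub>"
    using dx xc f.f_koszul_diff[of _ "p + 1" x N0] f.f_zero by simp
  obtain K q where q: "\<forall>S\<in>cech_index n (p - 1). q S \<in> carrier Q"
    and qd: "\<forall>T\<in>cech_index n p. monom (var_power T K) \<odot>\<^bsub>Q\<^esub> f (x T) = koszul_diff Q (N0 + K) q T"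
    by (rule lc_vanishE[OF Q fx dfx])
  obtain y where y: "\<forall>S\<in>cech_index n (p - 1). y S \<in> carrier M \<and> f (y S) = q S"
    using q by (rule lift_carrier)
  define N1 where "N1 = N0 + K"
  \<comment> \<open>The lift \<open>y\<close> may be inhomogeneous, but the hypothesis on
    \<open>N\<close> needs a homogeneous cocycle.\<close>
  define y' where "y' = (\<lambda>S. \<pi> (d + int N1 * (p - 1)) (y S))"
  define x1 where "x1 = (\<lambda>T. monom (var_power T K) \<odot>\<^bsub>M\<^esub> x T)"
  define w where "w = (\<lambda>T. x1 T \<ominus>\<^bsub>M\<^esub> koszul_diff M N1 y' T)"
  have yc: "y \<in> cech_index n (p - 1) \<rightarrow> carrier M"
    using y by auto
  have y'g: "\<forall>S\<in>cech_index n (p - 1). y' S \<in> grade M (d + int N1 * (p - 1))"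
    unfolding y'_def using y M.proj_grade by blast
  then have y'c: "y' \<in> cech_index n (p - 1) \<rightarrow> carrier M"
    using M.grade_carrier by blast
  have x1g: "x1 T \<in> grade M (d + int N1 * p)" if "T \<in> cech_index n p" for T
    unfolding x1_def N1_def using x that by (intro M.grade_var_power) auto
  then have x1c: "x1 \<in> cech_index n p \<rightarrow> carrier M"
    using M.grade_carrier by blast
  have w: "w T \<in> grade M (d + int N1 * p) \<inter> N" if T: "T \<in> cech_index n p" for T
  proof
    show "w T \<in> grade M (d + int N1 * p)"
      unfolding w_def by (intro M.grade_diff x1g[OF T] M.koszul_diff_grade[OF T y'g])
    \<comment> \<open>Membership in \<open>N\<close> is checked before projecting, since
      \<open>f\<close> sends \<open>x1\<close> and the differential of \<open>y\<close> to the same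
      element. Projection to degree \<open>d + N1 * p\<close> fixes \<open>x1\<close> and replaces
      \<open>y\<close> by \<open>y'\<close>, which gives \<open>w\<close>.\<close>
    note kc = M.koszul_diff_closed[OF T yc, of N1] and xT = funcset_mem[OF x1c T]
    have "f (koszul_diff M N1 y T) = koszul_diff Q N1 (\<lambda>S. f (y S)) T"
      by (rule f.f_koszul_diff[OF T yc])
    also have "\<dots> = koszul_diff Q N1 q T"
      using y q by (intro Q.koszul_diff_cong[OF T]) auto
    also have "\<dots> = f (x1 T)"
      unfolding x1_def N1_def using bspec[OF qd T] funcset_mem[OF xc T] M.keys_var_power_n[OF T]
      by (simp add: f.f_monom)
    finally have "x1 T \<ominus>\<^bsub>M\<^esub> koszul_diff M N1 y T \<in> N"
      using xT kc by (simp add: kernel f_diff a_minus_def[of Q] Q.r_neg)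
    then have "\<pi> (d + int N1 * p) (x1 T \<ominus>\<^bsub>M\<^esub> koszul_diff M N1 y T) \<in> N"
      by (rule proj_kernel)
    then show "w T \<in> N"
      using xT kc M.proj_koszul_diff[OF T yc, of d N1] M.proj_id[OF x1g[OF T]]
      by (simp add: M.proj_diff w_def y'_def)
  qed
  have wc: "w \<in> cech_index n p \<rightarrow> carrier M" and wN: "w \<in> cech_index n p \<rightarrow> N"
    using w N_carrier by auto
  have dw: "koszul_diff M N1 w T = \<zero>\<^bsub>M\<^esub>" if T: "T \<in> cech_index n (p + 1)" for T
  proof -
    have kc: "koszul_diff M N1 y' \<in> cech_index n p \<rightarrow> carrier M"
      using M.koszul_diff_closed[OF _ y'c] by auto
    have "koszul_diff M N1 w T = koszul_diff M N1 x1 T \<ominus>\<^bsub>M\<^esub> koszul_diff M N1 (koszul_diff M N1 y') T"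
      unfolding w_def using x1c kc by (intro M.koszul_diff_diff[OF T]) auto
    also have "koszul_diff M N1 (koszul_diff M N1 y') T = \<zero>\<^bsub>M\<^esub>"
      using y'c by (intro M.koszul_diff_koszul_diff[OF T]) auto
    also have "koszul_diff M N1 x1 T = monom (var_power T K) \<odot>\<^bsub>M\<^esub> koszul_diff M N0 x T"
      unfolding x1_def N1_def using xc by (intro M.koszul_diff_scale[OF T, symmetric]) auto
    also have "\<dots> = \<zero>\<^bsub>M\<^esub>"
      using dx T M.keys_var_power_n[OF T] by (simp add: M.monom_carrier)
    finally show ?thesis
      by (simp add: a_minus_def)
  qed
  have dw': "\<forall>T\<in>cech_index n (p + 1). koszul_diff (submod M N) N1 w T = \<zero>\<^bsub>submod M N\<^esub>"
    using dw koszul_diff_submod[of _ "p + 1" w N1] wN by simp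
  have wg: "\<forall>S\<in>cech_index n p. w S \<in> grade (submod M N) (d + int N1 * p)"
    using w by simp
  obtain K' z where z: "\<forall>S\<in>cech_index n (p - 1). z S \<in> carrier (submod M N)"
    and zd: "\<forall>T\<in>cech_index n p. monom (var_power T K') \<odot>\<^bsub>submod M N\<^esub> w T = koszul_diff (submod M N) (N1 + K') z T"
    by (rule lc_vanishE[OF A wg dw'])
  have zN: "z \<in> cech_index n (p - 1) \<rightarrow> N" and zc: "z \<in> cech_index n (p - 1) \<rightarrow> carrier M"
    using z N_carrier by auto
  have sc: "(\<lambda>S. monom (var_power S K') \<odot>\<^bsub>M\<^esub> y' S) \<in> cech_index n (p - 1) \<rightarrow> carrier M"
    using funcset_mem[OF y'c] M.keys_var_power_n by (auto intro!: M.monom_smult_closed)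
  show "\<exists>K y. (\<forall>S\<in>cech_index n (p - 1). y S \<in> carrier M) \<and>
      (\<forall>T\<in>cech_index n p. monom (var_power T K) \<odot>\<^bsub>M\<^esub> x T = koszul_diff M (N0 + K) y T)"
  proof (intro exI conjI ballI)
    \<comment> \<open>\<open>y'\<close> lives at level \<open>N1\<close> and \<open>z\<close> at
      level \<open>N1 + K'\<close>, so \<open>y'\<close> is moved up before the two are
      added.\<close>
    show "monom (var_power S K') \<odot>\<^bsub>M\<^esub> y' S \<oplus>\<^bsub>M\<^esub> z S \<in> carrier M" if "S \<in> cech_index n (p - 1)" for S
      using funcset_mem[OF sc that] funcset_mem[OF zc that] by simp
    fix T assume T: "T \<in> cech_index n p"
    note keys = M.keys_var_power_n[OF T]
    have kc: "koszul_diff M N1 y' T \<in> carrier M"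
      by (rule M.koszul_diff_closed[OF T y'c])
    have "koszul_diff M (N1 + K') (\<lambda>S. monom (var_power S K') \<odot>\<^bsub>M\<^esub> y' S \<oplus>\<^bsub>M\<^esub> z S) T =
      monom (var_power T K') \<odot>\<^bsub>M\<^esub> koszul_diff M N1 y' T \<oplus>\<^bsub>M\<^esub> monom (var_power T K') \<odot>\<^bsub>M\<^esub> w T"
      using M.koszul_diff_add[OF T sc zc] M.koszul_diff_scale[OF T y'c] bspec[OF zd T]
        koszul_diff_submod[OF T zN] by simp
    also have "\<dots> = monom (var_power T K') \<odot>\<^bsub>M\<^esub> (koszul_diff M N1 y' T \<oplus>\<^bsub>M\<^esub> w T)"
      using kc funcset_mem[OF wc T] keys by (simp add: M.monom_smult_add)
    also have "koszul_diff M N1 y' T \<oplus>\<^bsub>M\<^esub> w T = x1 T"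
      unfolding w_def using kc funcset_mem[OF x1c T]
      by (simp add: a_minus_def M.a_lcomm[of _ "x1 T"] M.r_neg)
    also have "monom (var_power T K') \<odot>\<^bsub>M\<^esub> x1 T = monom (var_power T (K + K')) \<odot>\<^bsub>M\<^esub> x T"
      unfolding x1_def using funcset_mem[OF xc T] keys by (simp add: var_power_add add.commute)
    finally show "monom (var_power T (K + K')) \<odot>\<^bsub>M\<^esub> x T =
      koszul_diff M (N0 + (K + K')) (\<lambda>S. monom (var_power S K') \<odot>\<^bsub>M\<^esub> y' S \<oplus>\<^bsub>M\<^esub> z S) T"
      by (simp add: N1_def add.assoc)
  qed
qed

text \<open>Exactness at the quotient, with the connecting map written out: the differential of a
  lift of \<open>x\<close> is a cocycle in \<open>N\<close>. If it bounds in \<open>N\<close>, the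
  lift can be corrected there to a cocycle of \<open>M\<close>, and what bounds this in
  \<open>M\<close> maps to what bounds \<open>x\<close> in \<open>Q\<close>.\<close>

lemma lc_vanish_quotient:
  assumes M: "lc_vanish n M p d" and A: "lc_vanish n (submod M N) (p + 1) d"
  shows "lc_vanish n Q p d"
  unfolding lc_vanish_def
proof clarify
  fix N0 x
  assume x: "\<forall>S\<in>cech_index n p. x S \<in> grade Q (d + int N0 * p)"
    and dx: "\<forall>T\<in>cech_index n (p + 1). koszul_diff Q N0 x T = \<zero>\<^bsub>Q\<^esub>"
  obtain w where w: "\<forall>S\<in>cech_index n p. w S \<in> grade M (d + int N0 * p) \<and> f (w S) = x S"
    using x by (rule lift_grade)
  have wc: "w \<in> cech_index n p \<rightarrow> carrier M"
    using w M.grade_carrier by blast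
  \<comment> \<open>\<open>?v\<close> represents the image of \<open>x\<close> under the connecting
    map.\<close>
  let ?v = "koszul_diff M N0 w"
  have v: "?v T \<in> grade M (d + int N0 * (p + 1)) \<inter> N" if T: "T \<in> cech_index n (p + 1)" for T
  proof
    show "?v T \<in> grade M (d + int N0 * (p + 1))"
      using w by (intro M.koszul_diff_grade[OF T]) auto
    have "f (?v T) = koszul_diff Q N0 (\<lambda>S. f (w S)) T"
      using wc by (intro f.f_koszul_diff[OF T]) auto
    also have "\<dots> = koszul_diff Q N0 x T"
      using w x Q.grade_carrier by (intro Q.koszul_diff_cong[OF T]) auto
    finally show "?v T \<in> N"
      using dx T M.koszul_diff_closed[OF T, of w N0] wc by (simp add: kernel)
  qed
  have vN: "?v \<in> cech_index n (p + 1) \<rightarrow> N" and vc: "?v \<in> cech_index n (p + 1) \<rightarrow> carrier M"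
    using v N_carrier by auto
  have dv: "\<forall>T\<in>cech_index n (p + 1 + 1). koszul_diff (submod M N) N0 ?v T = \<zero>\<^bsub>submod M N\<^esub>"
  proof
    fix T assume T: "T \<in> cech_index n (p + 1 + 1)"
    have "koszul_diff (submod M N) N0 ?v T = koszul_diff M N0 ?v T"
      using vN by (intro koszul_diff_submod[OF T]) (simp add: add.commute)
    also have "\<dots> = \<zero>\<^bsub>M\<^esub>"
      using wc by (intro M.koszul_diff_koszul_diff[OF T]) auto
    finally show "koszul_diff (submod M N) N0 ?v T = \<zero>\<^bsub>submod M N\<^esub>"
      by simp
  qed
  have vg: "\<forall>S\<in>cech_index n (p + 1). ?v S \<in> grade (submod M N) (d + int N0 * (p + 1))"
    using v by simp
  obtain K z where z: "\<forall>S\<in>cech_index n (p + 1 - 1). z S \<in> carrier (submod M N)"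
    and zd: "\<forall>T\<in>cech_index n (p + 1). monom (var_power T K) \<odot>\<^bsub>submod M N\<^esub> ?v T = koszul_diff (submod M N) (N0 + K) z T"
    by (rule lc_vanishE[OF A vg dv])
  define N1 where "N1 = N0 + K"
  \<comment> \<open>The component \<open>z'\<close> has the same differential as \<open>z\<close>,
    since that differential is homogeneous. Subtracting it keeps \<open>w1\<close> homogeneous, as
    the hypothesis on \<open>M\<close> demands.\<close>
  define z' where "z' = (\<lambda>S. \<pi> (d + int N1 * p) (z S))"
  define w1 where "w1 = (\<lambda>S. monom (var_power S K) \<odot>\<^bsub>M\<^esub> w S \<ominus>\<^bsub>M\<^esub> z' S)"
  have zN: "z \<in> cech_index n p \<rightarrow> N" and zc: "z \<in> cech_index n p \<rightarrow> carrier M"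
    using z N_carrier by auto
  have z': "z' S \<in> grade M (d + int N1 * p)" "z' S \<in> N" if "S \<in> cech_index n p" for S
    using M.proj_grade[OF funcset_mem[OF zc that]] proj_kernel[OF funcset_mem[OF zN that]]
    by (simp_all add: z'_def)
  then have z'c: "z' \<in> cech_index n p \<rightarrow> carrier M"
    using N_carrier by auto
  have sg: "monom (var_power S K) \<odot>\<^bsub>M\<^esub> w S \<in> grade M (d + int N1 * p)" if "S \<in> cech_index n p" for S
    unfolding N1_def using w that by (intro M.grade_var_power) auto
  then have sc: "(\<lambda>S. monom (var_power S K) \<odot>\<^bsub>M\<^esub> w S) \<in> cech_index n p \<rightarrow> carrier M"
    using M.grade_carrier by blast
  have w1g: "\<forall>S\<in>cech_index n p. w1 S \<in> grade M (d + int N1 * p)"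
    unfolding w1_def using sg z' M.grade_diff by blast
  have dw1: "\<forall>T\<in>cech_index n (p + 1). koszul_diff M N1 w1 T = \<zero>\<^bsub>M\<^esub>"
  proof
    fix T assume T: "T \<in> cech_index n (p + 1)"
    note keys = M.keys_var_power_n[OF T]
    have vT: "monom (var_power T K) \<odot>\<^bsub>M\<^esub> ?v T \<in> grade M (d + int N1 * (p + 1))"
      unfolding N1_def using v[OF T] by (intro M.grade_var_power[OF T]) auto
    have "koszul_diff M N1 z' T = koszul_diff M N1 (\<lambda>S. \<pi> (d + int N1 * (p + 1 - 1)) (z S)) T"
      by (simp add: z'_def)
    also have "\<dots> = \<pi> (d + int N1 * (p + 1)) (koszul_diff M N1 z T)"
      using zc by (intro M.proj_koszul_diff[OF T, symmetric]) auto
    also have "koszul_diff M N1 z T = monom (var_power T K) \<odot>\<^bsub>M\<^esub> ?v T"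
      using bspec[OF zd T] koszul_diff_submod[OF T, of z] zN by (simp add: N1_def)
    also have "\<pi> (d + int N1 * (p + 1)) \<dots> = monom (var_power T K) \<odot>\<^bsub>M\<^esub> ?v T"
      by (rule M.proj_id[OF vT])
    finally have z'd: "koszul_diff M N1 z' T = monom (var_power T K) \<odot>\<^bsub>M\<^esub> ?v T" .
    have "koszul_diff M N1 w1 T =
        koszul_diff M N1 (\<lambda>S. monom (var_power S K) \<odot>\<^bsub>M\<^esub> w S) T \<ominus>\<^bsub>M\<^esub> koszul_diff M N1 z' T"
      unfolding w1_def using sc z'c by (intro M.koszul_diff_diff[OF T]) auto
    also have "koszul_diff M N1 (\<lambda>S. monom (var_power S K) \<odot>\<^bsub>M\<^esub> w S) T = monom (var_power T K) \<odot>\<^bsub>M\<^esub> ?v T"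
      unfolding N1_def using wc by (intro M.koszul_diff_scale[OF T, symmetric]) auto
    finally show "koszul_diff M N1 w1 T = \<zero>\<^bsub>M\<^esub>"
      using M.grade_carrier[OF vT] by (simp add: z'd a_minus_def M.r_neg)
  qed
  obtain K' y where y: "\<forall>S\<in>cech_index n (p - 1). y S \<in> carrier M"
    and yd: "\<forall>T\<in>cech_index n p. monom (var_power T K') \<odot>\<^bsub>M\<^esub> w1 T = koszul_diff M (N1 + K') y T"
    by (rule lc_vanishE[OF M w1g dw1])
  show "\<exists>K y. (\<forall>S\<in>cech_index n (p - 1). y S \<in> carrier Q) \<and>
      (\<forall>T\<in>cech_index n p. monom (var_power T K) \<odot>\<^bsub>Q\<^esub> x T = koszul_diff Q (N0 + K) y T)"
  proof (intro exI conjI ballI)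
    show "f (y S) \<in> carrier Q" if "S \<in> cech_index n (p - 1)" for S
      using y that by simp
    fix T assume T: "T \<in> cech_index n p"
    note keys = M.keys_var_power_n[OF T]
    have wT: "w T \<in> carrier M" "f (w T) = x T" "x T \<in> carrier Q"
      using T w wc x Q.grade_carrier by auto
    have z'T: "z' T \<in> carrier M" "f (z' T) = \<zero>\<^bsub>Q\<^esub>"
      using z'(2)[OF T] by (simp_all add: kernel)
    have "koszul_diff Q (N1 + K') (\<lambda>S. f (y S)) T = f (koszul_diff M (N1 + K') y T)"
      using y by (intro f.f_koszul_diff[OF T, symmetric]) auto
    also have "\<dots> = f (monom (var_power T K') \<odot>\<^bsub>M\<^esub> w1 T)"
      using yd T by simp
    also have "\<dots> = monom (var_power T K') \<odot>\<^bsub>Q\<^esub> f (w1 T)"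
      using w1g T M.grade_carrier keys by (intro f.f_monom) auto
    also have "f (w1 T) = monom (var_power T K) \<odot>\<^bsub>Q\<^esub> x T"
      unfolding w1_def using wT z'T keys by (simp add: f_diff f.f_monom a_minus_def[of Q])
    also have "monom (var_power T K') \<odot>\<^bsub>Q\<^esub> \<dots> = monom (var_power T (K + K')) \<odot>\<^bsub>Q\<^esub> x T"
      using wT keys by (simp add: var_power_add add.commute)
    finally show "monom (var_power T (K + K')) \<odot>\<^bsub>Q\<^esub> x T = koszul_diff Q (N0 + (K + K')) (\<lambda>S. f (y S)) T"
      by (simp add: N1_def add.assoc)
  qed
qed

text \<open>Exactness at the submodule: \<open>x\<close> bounds some \<open>y\<close> in
  \<open>M\<close>, whose image in \<open>Q\<close> is a cocycle one index lower. If that image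
  bounds, a Koszul boundary can be subtracted from \<open>y\<close> to move it into \<open>N\<close>
  without changing its differential.\<close>

lemma lc_vanish_sub:
  assumes Q: "lc_vanish n Q (p - 1) d" and M: "lc_vanish n M p d"
  shows "lc_vanish n (submod M N) p d"
  unfolding lc_vanish_def
proof clarify
  fix N0 x
  assume "\<forall>S\<in>cech_index n p. x S \<in> grade (submod M N) (d + int N0 * p)"
    and dx: "\<forall>T\<in>cech_index n (p + 1). koszul_diff (submod M N) N0 x T = \<zero>\<^bsub>submod M N\<^esub>"
  then have xg: "\<forall>S\<in>cech_index n p. x S \<in> grade M (d + int N0 * p)"
    and xN: "x \<in> cech_index n p \<rightarrow> N"
    by auto
  have xc: "x \<in> cech_index n p \<rightarrow> carrier M"
    using xN N_carrier by auto
  have dx': "\<forall>T\<in>cech_index n (p + 1). koszul_diff M N0 x T = \<zero>\<^bsub>M\<^esub>"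
    using dx koszul_diff_submod[of _ "p + 1" x N0] xN by simp
  obtain K y where y: "\<forall>S\<in>cech_index n (p - 1). y S \<in> carrier M"
    and yd: "\<forall>T\<in>cech_index n p. monom (var_power T K) \<odot>\<^bsub>M\<^esub> x T = koszul_diff M (N0 + K) y T"
    by (rule lc_vanishE[OF M xg dx'])
  define N1 where "N1 = N0 + K"
  define y' where "y' = (\<lambda>S. \<pi> (d + int N1 * (p - 1)) (y S))"
  have yc: "y \<in> cech_index n (p - 1) \<rightarrow> carrier M"
    using y by auto
  have y'g: "y' S \<in> grade M (d + int N1 * (p - 1))" if "S \<in> cech_index n (p - 1)" for S
    unfolding y'_def using y that M.proj_grade by blast
  then have y'c: "y' \<in> cech_index n (p - 1) \<rightarrow> carrier M"
    using M.grade_carrier by blast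
  have y'd: "koszul_diff M N1 y' T = monom (var_power T K) \<odot>\<^bsub>M\<^esub> x T" if T: "T \<in> cech_index n p" for T
  proof -
    have "monom (var_power T K) \<odot>\<^bsub>M\<^esub> x T \<in> grade M (d + int N1 * p)"
      unfolding N1_def using xg T by (intro M.grade_var_power[OF T]) auto
    then show ?thesis
      using M.proj_koszul_diff[OF T yc, of d N1] bspec[OF yd T] M.proj_id by (simp add: y'_def N1_def)
  qed
  have fy'g: "\<forall>S\<in>cech_index n (p - 1). f (y' S) \<in> grade Q (d + int N1 * (p - 1))"
    using y'g f_grade by blast
  have dfy': "\<forall>T\<in>cech_index n (p - 1 + 1). koszul_diff Q N1 (\<lambda>S. f (y' S)) T = \<zero>\<^bsub>Q\<^esub>"
  proof
    fix T assume "T \<in> cech_index n (p - 1 + 1)"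
    then have T: "T \<in> cech_index n p"
      by simp
    have "f (x T) = \<zero>\<^bsub>Q\<^esub>"
      using funcset_mem[OF xN T] by (simp add: kernel)
    then show "koszul_diff Q N1 (\<lambda>S. f (y' S)) T = \<zero>\<^bsub>Q\<^esub>"
      using f.f_koszul_diff[OF T y'c, of N1] y'd[OF T] funcset_mem[OF xc T] M.keys_var_power_n[OF T]
      by (simp add: f.f_monom M.monom_carrier)
  qed
  obtain K' q where q: "\<forall>S\<in>cech_index n (p - 1 - 1). q S \<in> carrier Q"
    and qd: "\<forall>S\<in>cech_index n (p - 1). monom (var_power S K') \<odot>\<^bsub>Q\<^esub> f (y' S) = koszul_diff Q (N1 + K') q S"
    by (rule lc_vanishE[OF Q fy'g dfy'])
  obtain v where v: "\<forall>S\<in>cech_index n (p - 1 - 1). v S \<in> carrier M \<and> f (v S) = q S"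
    using q by (rule lift_carrier)
  have vc: "v \<in> cech_index n (p - 1 - 1) \<rightarrow> carrier M"
    using v by auto
  let ?s = "\<lambda>S. monom (var_power S K') \<odot>\<^bsub>M\<^esub> y' S"
  \<comment> \<open>\<open>f\<close> sends both terms to the same element. This is the final
    witness, of which only values in \<open>N\<close> are asked, so \<open>v\<close> may stay
    inhomogeneous.\<close>
  let ?a = "\<lambda>S. ?s S \<ominus>\<^bsub>M\<^esub> koszul_diff M (N1 + K') v S"
  have sc: "?s \<in> cech_index n (p - 1) \<rightarrow> carrier M"
    using funcset_mem[OF y'c] M.keys_var_power_n by (auto intro!: M.monom_smult_closed)
  have kc: "koszul_diff M (N1 + K') v \<in> cech_index n (p - 1) \<rightarrow> carrier M"
    using M.koszul_diff_closed[OF _ vc] by auto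
  have a: "?a S \<in> N" if S: "S \<in> cech_index n (p - 1)" for S
  proof -
    have "f (koszul_diff M (N1 + K') v S) = koszul_diff Q (N1 + K') (\<lambda>S. f (v S)) S"
      by (rule f.f_koszul_diff[OF S vc])
    also have "\<dots> = koszul_diff Q (N1 + K') q S"
      using v q by (intro Q.koszul_diff_cong[OF S]) auto
    also have "\<dots> = f (?s S)"
      using bspec[OF qd S] funcset_mem[OF y'c S] M.keys_var_power_n[OF S] by (simp add: f.f_monom)
    finally show ?thesis
      using funcset_mem[OF sc S] funcset_mem[OF kc S]
      by (simp add: kernel f_diff a_minus_def[of Q] Q.r_neg)
  qed
  show "\<exists>K y. (\<forall>S\<in>cech_index n (p - 1). y S \<in> carrier (submod M N)) \<and>
      (\<forall>T\<in>cech_index n p. monom (var_power T K) \<odot>\<^bsub>submod M N\<^esub> x T = koszul_diff (submod M N) (N0 + K) y T)"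
  proof (intro exI conjI ballI)
    show "?a S \<in> carrier (submod M N)" if "S \<in> cech_index n (p - 1)" for S
      using a[OF that] by simp
    fix T assume T: "T \<in> cech_index n p"
    note keys = M.keys_var_power_n[OF T]
    have "koszul_diff (submod M N) (N1 + K') ?a T = koszul_diff M (N1 + K') ?a T"
      using a by (intro koszul_diff_submod[OF T]) auto
    also have "\<dots> = koszul_diff M (N1 + K') ?s T \<ominus>\<^bsub>M\<^esub> koszul_diff M (N1 + K') (koszul_diff M (N1 + K') v) T"
      by (rule M.koszul_diff_diff[OF T sc kc])
    also have "koszul_diff M (N1 + K') (koszul_diff M (N1 + K') v) T = \<zero>\<^bsub>M\<^esub>"
      by (rule M.koszul_diff_koszul_diff[OF T vc])
    also have "koszul_diff M (N1 + K') ?s T = monom (var_power T (K + K')) \<odot>\<^bsub>M\<^esub> x T"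
      using M.koszul_diff_scale[OF T y'c, of K' N1] y'd[OF T] funcset_mem[OF xc T] keys
      by (simp add: var_power_add add.commute)
    finally have "koszul_diff (submod M N) (N1 + K') ?a T = monom (var_power T (K + K')) \<odot>\<^bsub>M\<^esub> x T"
      using funcset_mem[OF xc T] keys by (simp add: a_minus_def)
    then show "monom (var_power T (K + K')) \<odot>\<^bsub>submod M N\<^esub> x T = koszul_diff (submod M N) (N0 + (K + K')) ?a T"
      by (simp add: N1_def add.assoc)
  qed
qed

end


section \<open>Homogeneous components, submodules and quotients\<close>

definition grade_proj :: "('a, 'b) graded_module \<Rightarrow> int \<Rightarrow> 'b \<Rightarrow> 'b" where
  "grade_proj M d x = (THE f. (\<forall>d. f d \<in> grade M d) \<and> finite {d. f d \<noteq> \<zero>\<^bsub>M\<^esub>} \<and>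
     x = (\<Oplus>\<^bsub>M\<^esub>d\<in>{d. f d \<noteq> \<zero>\<^bsub>M\<^esub>}. f d)) d"

section \<open>Components of the homogeneous decomposition\<close>

context graded_mpoly_module
begin

lemma grade_closed: "x \<in> grade M d \<Longrightarrow> x \<in> carrier M"
  using subgroup.subset[OF grade_subgroup[of d]] by auto

lemma grade_zero: "\<zero> \<in> grade M d"
  using subgroup.one_closed[OF grade_subgroup[of d]] by simp

lemma finsum_support:
  assumes "finite F" "\<And>d. g d \<in> grade M d" "\<And>d. d \<notin> F \<Longrightarrow> g d = \<zero>"
  shows "(\<Oplus>d\<in>{d. g d \<noteq> \<zero>}. g d) = (\<Oplus>d\<in>F. g d)"
  using assms grade_closed by (intro add.finprod_mono_neutral_cong_left) auto

text \<open>\<open>F\<close> may exceed the support of \<open>g\<close>. This matters for sums,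
  where components can cancel, and for images, where they can become zero.\<close>

lemma grade_proj_eqI:
  assumes F: "finite F" "\<And>d. d \<notin> F \<Longrightarrow> g d = \<zero>"
    and g: "\<And>d. g d \<in> grade M d" and x: "x = (\<Oplus>d\<in>F. g d)"
  shows "grade_proj M d x = g d"
proof -
  have "x \<in> carrier M"
    unfolding x using g grade_closed by (intro finsum_closed) auto
  have "{d. g d \<noteq> \<zero>} \<subseteq> F"
    using F(2) by blast
  then have "finite {d. g d \<noteq> \<zero>}"
    using F(1) finite_subset by blast
  moreover have "x = (\<Oplus>d\<in>{d. g d \<noteq> \<zero>}. g d)"
    unfolding x using F(1) g F(2) by (rule finsum_support[symmetric])
  ultimately have "(THE f. (\<forall>d. f d \<in> grade M d) \<and> finite {d. f d \<noteq> \<zero>} \<and>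
     x = (\<Oplus>d\<in>{d. f d \<noteq> \<zero>}. f d)) = g"
    using g by (intro the1_equality[OF grade_decomposition[OF \<open>x \<in> carrier M\<close>]]) auto
  then show ?thesis
    by (simp add: grade_proj_def)
qed

lemma grade_proj_grade: "x \<in> carrier M \<Longrightarrow> grade_proj M d x \<in> grade M d"
  unfolding grade_proj_def using theI'[OF grade_decomposition] by blast

text \<open>The decomposition holds over every finite set containing \<open>F\<close>, so that two
  elements can be expanded over one index set.\<close>

lemma grade_proj_sum:
  assumes "x \<in> carrier M"
  obtains F where "finite F" "\<And>d. d \<notin> F \<Longrightarrow> grade_proj M d x = \<zero>"
    "\<And>F'. finite F' \<Longrightarrow> F \<subseteq> F' \<Longrightarrow> x = (\<Oplus>d\<in>F'. grade_proj M d x)"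
proof -
  let ?F = "{d. grade_proj M d x \<noteq> \<zero>}"
  have *: "finite ?F \<and> x = (\<Oplus>d\<in>?F. grade_proj M d x)"
    unfolding grade_proj_def using theI'[OF grade_decomposition[OF assms]] by blast
  have "x = (\<Oplus>d\<in>F'. grade_proj M d x)" if "finite F'" "?F \<subseteq> F'" for F'
    using * finsum_support[of F' "\<lambda>d. grade_proj M d x"] that grade_proj_grade[OF assms] by auto
  with * show thesis
    by (intro that[of ?F]) auto
qed

lemma grade_proj_add:
  assumes x: "x \<in> carrier M" and y: "y \<in> carrier M"
  shows "grade_proj M d (x \<oplus> y) = grade_proj M d x \<oplus> grade_proj M d y"
proof -
  obtain F where F: "finite F" "\<And>d. d \<notin> F \<Longrightarrow> grade_proj M d x = \<zero>"
    "\<And>F'. finite F' \<Longrightarrow> F \<subseteq> F' \<Longrightarrow> x = (\<Oplus>d\<in>F'. grade_proj M d x)"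
    using grade_proj_sum[OF x] by blast
  obtain E where E: "finite E" "\<And>d. d \<notin> E \<Longrightarrow> grade_proj M d y = \<zero>"
    "\<And>F'. finite F' \<Longrightarrow> E \<subseteq> F' \<Longrightarrow> y = (\<Oplus>d\<in>F'. grade_proj M d y)"
    using grade_proj_sum[OF y] by blast
  note px = grade_proj_grade[OF x] and py = grade_proj_grade[OF y]
  have "x \<oplus> y = (\<Oplus>d\<in>F \<union> E. grade_proj M d x) \<oplus> (\<Oplus>d\<in>F \<union> E. grade_proj M d y)"
    using F(1) E(1) F(3)[of "F \<union> E"] E(3)[of "F \<union> E"] by simp
  also have "\<dots> = (\<Oplus>d\<in>F \<union> E. grade_proj M d x \<oplus> grade_proj M d y)"
    using px py grade_closed by (intro finsum_addf[symmetric]) auto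
  finally have sum: "x \<oplus> y = (\<Oplus>d\<in>F \<union> E. grade_proj M d x \<oplus> grade_proj M d y)" .
  have "grade_proj M d x \<oplus> grade_proj M d y \<in> grade M d" for d
    using subgroup.m_closed[OF grade_subgroup px py] by simp
  then show ?thesis
    using F(1,2) E(1,2) by (intro grade_proj_eqI[OF _ _ _ sum]) auto
qed

lemma grade_proj_id: "x \<in> grade M d \<Longrightarrow> grade_proj M d x = x"
  using grade_proj_eqI[of "{d}" "\<lambda>e. if e = d then x else \<zero>" x d] grade_zero grade_closed by auto

lemma monom_smult_grade:
  assumes "Poly_Mapping.keys t \<subseteq> {..<n}" "x \<in> grade M d"
  shows "monom t \<odot> x \<in> grade M (d + int (monom_degree t))"
proof -
  have "(monom t :: 'k mpoly) \<in> homogeneous n (int (monom_degree t))"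
    using assms by (auto simp: homogeneous_def monom_def mpoly_ring_def)
  from grade_smult[OF this assms(2)] show ?thesis
    by (simp add: add.commute)
qed

lemma graded_projections: "graded_projections n M (grade_proj M)"
proof -
  interpret mpoly_module n M ..
  show ?thesis
  proof (intro graded_projections.intro mpoly_module_grading.intro mpoly_module_axioms
      mpoly_module_grading_axioms.intro graded_projections_axioms.intro)
    fix x d and t :: "nat \<Rightarrow>\<^sub>0 nat"
    assume t: "Poly_Mapping.keys t \<subseteq> {..<n}" and x: "x \<in> carrier M"
    let ?t = "int (monom_degree t)"
    obtain F where F: "finite F" "\<And>d. d \<notin> F \<Longrightarrow> grade_proj M d x = \<zero>"
      "\<And>F'. finite F' \<Longrightarrow> F \<subseteq> F' \<Longrightarrow> x = (\<Oplus>d\<in>F'. grade_proj M d x)"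
      using grade_proj_sum[OF x] by blast
    note px = grade_proj_grade[OF x]
    have "monom t \<odot> x = monom t \<odot> (\<Oplus>d\<in>F. grade_proj M d x)"
      using F(3)[OF F(1)] by simp
    also have "\<dots> = (\<Oplus>d\<in>F. monom t \<odot> grade_proj M d x)"
      using F(1) grade_closed[OF px] monom_carrier[OF t] by (intro finsum_smult_ldistr) auto
    \<comment> \<open>Multiplication by a monomial shifts all degrees by \<open>?t\<close>. After
      this reindexing the terms are indexed by their own degrees and uniqueness applies.\<close>
    also have "\<dots> = (\<Oplus>e\<in>(\<lambda>d. d + ?t) ` F. monom t \<odot> grade_proj M (e - ?t) x)"
      using monom_smult_closed[OF t grade_closed[OF px]]
      by (subst add.finprod_reindex) (auto simp: inj_on_def)
    finally have sum: "monom t \<odot> x = (\<Oplus>e\<in>(\<lambda>d. d + ?t) ` F. monom t \<odot> grade_proj M (e - ?t) x)" .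
    have "monom t \<odot> grade_proj M (e - ?t) x \<in> grade M e" for e
      using monom_smult_grade[OF t px[of "e - ?t"]] by simp
    moreover have "monom t \<odot> grade_proj M (e - ?t) x = \<zero>" if "e \<notin> (\<lambda>d. d + ?t) ` F" for e
      using that F(2)[of "e - ?t"] monom_carrier[OF t] by (force simp: image_iff)
    ultimately show "grade_proj M (d + ?t) (monom t \<odot> x) = monom t \<odot> grade_proj M d x"
      using F(1) grade_proj_eqI[OF _ _ _ sum, of "d + ?t"] by simp
  qed (use grade_closed monom_smult_grade grade_subgroup grade_proj_grade grade_proj_add grade_proj_id in blast)+
qed

end

text \<open>A map of degree 0 sends the decomposition of \<open>x\<close> to a decomposition of
  \<open>f x\<close>. Hence kernels and images are stable under the projections.\<close>

lemma grade_proj_hom: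
  assumes "graded_mpoly_module n M" "graded_mpoly_module n N" "f \<in> graded_hom n M N" "x \<in> carrier M"
  shows "grade_proj N d (f x) = f (grade_proj M d x)"
proof -
  interpret M: graded_mpoly_module n M by fact
  interpret N: graded_mpoly_module n N by fact
  interpret f: mpoly_module_hom n M N f
    using assms(3) by unfold_locales (auto simp: mpoly_hom_def graded_hom_def)
  obtain F where F: "finite F" "\<And>d. d \<notin> F \<Longrightarrow> grade_proj M d x = \<zero>\<^bsub>M\<^esub>"
    "\<And>F'. finite F' \<Longrightarrow> F \<subseteq> F' \<Longrightarrow> x = (\<Oplus>\<^bsub>M\<^esub>d\<in>F'. grade_proj M d x)"
    using M.grade_proj_sum[OF assms(4)] by blast
  note px = M.grade_proj_grade[OF assms(4)]
  have "f x = f (\<Oplus>\<^bsub>M\<^esub>d\<in>F. grade_proj M d x)"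
    using F(3)[OF F(1)] by simp
  also have "\<dots> = (\<Oplus>\<^bsub>N\<^esub>d\<in>F. f (grade_proj M d x))"
    using F(1) px M.grade_closed
    by (intro finsum_additive M.abelian_group_axioms N.abelian_group_axioms f.f_add) auto
  finally show ?thesis
    using F px M.grade_closed assms(3)
    by (intro N.grade_proj_eqI[of F]) (auto simp: f.f_zero graded_hom_def)
qed

section \<open>Kernels, images and quotients\<close>

lemma submodule_module:
  assumes "mpoly_module n M" "submodule N (mpoly_ring n) M"
  shows "mpoly_module n (submod M N)"
proof -
  interpret mpoly_module n M by fact
  have N: "N \<subseteq> carrier M"
    using submoduleE(1)[OF assms(2)] .
  \<comment> \<open>\<open>submod\<close> changes the grading as well as the carrier. The group
    axioms do not see the grading, so they carry over.\<close>
  have "abelian_group (M\<lparr>carrier := N\<rparr>)"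
    using submodule.submodule_is_module[OF assms(2) module_axioms] by (rule module.axioms(2))
  then have "abelian_group (submod M N)"
    by (simp add: abelian_group_def abelian_monoid_def abelian_group_axioms_def submod_def)
  then have "module (mpoly_ring n) (submod M N)"
    using submoduleE(4)[OF assms(2)]
    by (intro moduleI R.is_cring) (auto simp: subsetD[OF N] smult_l_distr smult_r_distr smult_assoc1)
  then show ?thesis
    by (rule mpoly_module.intro)
qed

lemma graded_projections_submod:
  assumes "graded_projections n M \<pi>" "submodule N (mpoly_ring n) M" "\<And>x d. x \<in> N \<Longrightarrow> \<pi> d x \<in> N"
  shows "graded_projections n (submod M N) \<pi>"
proof -
  interpret graded_projections n M \<pi> by fact
  interpret N: mpoly_module n "submod M N"
    using mpoly_module_axioms assms(2) by (rule submodule_module)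
  have N: "x \<in> carrier M" if "x \<in> N" for x
    using submoduleE(1)[OF assms(2)] that by blast
  \<comment> \<open>Inverses are relative to the carrier of a record, so the two negations must be
    identified before closure of the grades can be transferred.\<close>
  have minus: "\<ominus>\<^bsub>submod M N\<^esub> x = \<ominus>\<^bsub>M\<^esub> x" if "x \<in> N" for x
    using that N submoduleE(3)[OF assms(2)] by (intro N.minus_equality) (auto simp: l_neg)
  show ?thesis
  proof (intro graded_projections.intro mpoly_module_grading.intro N.mpoly_module_axioms
      mpoly_module_grading_axioms.intro graded_projections_axioms.intro)
    fix d
    show "subgroup (grade (submod M N) d) (add_monoid (submod M N))"
    proof (rule N.add.subgroupI)
      show "grade (submod M N) d \<noteq> {}"
        using subgroup.one_closed[OF grade_subgroup[of d]] N.zero_closed by auto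
      show "\<ominus>\<^bsub>submod M N\<^esub> x \<in> grade (submod M N) d" if "x \<in> grade (submod M N) d" for x
        using that minus grade_minus submoduleE(3)[OF assms(2)] by auto
      show "x \<oplus>\<^bsub>submod M N\<^esub> y \<in> grade (submod M N) d"
        if "x \<in> grade (submod M N) d" "y \<in> grade (submod M N) d" for x y
        using that subgroup.m_closed[OF grade_subgroup[of d], of x y] submoduleE(5)[OF assms(2)] by auto
    qed auto
  next
    fix t :: "nat \<Rightarrow>\<^sub>0 nat" and x d
    assume "Poly_Mapping.keys t \<subseteq> {..<n}" "x \<in> grade (submod M N) d"
    then show "monom t \<odot>\<^bsub>submod M N\<^esub> x \<in> grade (submod M N) (d + int (monom_degree t))"
      using N.monom_smult_closed[of t x] grade_monom[of t x d] by simp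
  qed (use N assms(3) in \<open>auto simp: proj_grade proj_add proj_id proj_monom\<close>)
qed

context mpoly_module_hom
begin

lemma kernel_submodule: "submodule {x \<in> carrier M. f x = \<zero>\<^bsub>N\<^esub>} (mpoly_ring n) M"
  by (rule M.submoduleI) (auto simp: f_zero f_minus f_add f_smult)

lemma image_submodule: "submodule (f ` carrier M) (mpoly_ring n) N"
proof (rule N.submoduleI)
  show "\<zero>\<^bsub>N\<^esub> \<in> f ` carrier M"
    using f_zero[symmetric] by (rule image_eqI) simp
qed (auto simp flip: f_minus f_add f_smult)

end

lemma (in mpoly_module) quot_module_hom:
  assumes B: "submodule B (mpoly_ring n) M"
  shows "mpoly_module_hom n M (quot M B) (\<lambda>x. B +> x)"
    and "x \<in> carrier M \<Longrightarrow> B +> x = B \<longleftrightarrow> x \<in> B"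
    and "carrier (quot M B) = (\<lambda>x. B +> x) ` carrier M"
proof -
  let ?h = "\<lambda>x. B +> x"
  have sub: "subgroup B (add_monoid M)"
    using B by (simp add: submodule_def)
  interpret B: abelian_subgroup B M
    by (intro abelian_subgroupI3 additive_subgroupI sub abelian_group_axioms)
  show mem: "?h x = B \<longleftrightarrow> x \<in> B" if "x \<in> carrier M" for x
    using that B.a_rcos_self[of x] a_coset_join2[OF _ sub] by auto
  show carrier: "carrier (quot M B) = ?h ` carrier M"
    by (auto simp: quot_def A_RCOSETS_def')
  have zero: "\<zero>\<^bsub>quot M B\<^esub> = ?h \<zero>"
    by (simp add: quot_def B.a_subset)
  have add: "?h x \<oplus>\<^bsub>quot M B\<^esub> ?h y = ?h (x \<oplus> y)" if "x \<in> carrier M" "y \<in> carrier M" for x y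
    using that by (simp add: quot_def B.a_rcos_sum)
  have smult: "r \<odot>\<^bsub>quot M B\<^esub> ?h x = ?h (r \<odot> x)"
    if r: "r \<in> carrier (mpoly_ring n)" and x: "x \<in> carrier M" for r x
  proof -
    \<comment> \<open>Well-definedness of the action on cosets: changing a representative by
      \<open>b\<close> in \<open>B\<close> changes its multiple by \<open>r\<close> times
      \<open>b\<close>, again in \<open>B\<close>.\<close>
    have const: "?h (r \<odot> y) = ?h (r \<odot> x)" if y: "y \<in> ?h x" for y
    proof -
      obtain b where b: "b \<in> B" "y = b \<oplus> x"
        using y by (auto simp: a_r_coset_def')
      then have "r \<odot> y = r \<odot> b \<oplus> r \<odot> x"
        using r x B.a_subset by (auto simp: smult_r_distr)
      moreover have "r \<odot> b \<in> B"
        using submoduleE(4)[OF B r b(1)] .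
      ultimately have "r \<odot> y \<in> ?h (r \<odot> x)"
        by (auto simp: a_r_coset_def')
      then show ?thesis
        using r x by (intro a_repr_independence[symmetric] sub) auto
    qed
    have "r \<odot>\<^bsub>quot M B\<^esub> ?h x = (\<Union>y\<in>?h x. ?h (r \<odot> x))"
      unfolding quot_def using const by auto
    then show ?thesis
      using B.a_rcos_self[OF x] by auto
  qed
  have group: "abelian_group (quot M B)"
  proof (rule abelian_groupI, unfold carrier)
    show "\<exists>b\<in>?h ` carrier M. b \<oplus>\<^bsub>quot M B\<^esub> a = \<zero>\<^bsub>quot M B\<^esub>" if a: "a \<in> ?h ` carrier M" for a
    proof -
      obtain x where x: "x \<in> carrier M" "a = ?h x"
        using a by blast
      then have "?h (\<ominus> x) \<oplus>\<^bsub>quot M B\<^esub> a = \<zero>\<^bsub>quot M B\<^esub>"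
        by (simp add: add zero l_neg)
      with x show ?thesis
        by blast
    qed
  qed (auto simp: zero add a_ac)
  have "module (mpoly_ring n) (quot M B)"
    by (intro moduleI R.is_cring group; unfold carrier)
      (auto simp: smult add smult_l_distr smult_r_distr smult_assoc1)
  then show "mpoly_module_hom n M (quot M B) ?h"
    by (intro mpoly_module_hom.intro mpoly_module_axioms mpoly_module.intro mpoly_module_hom_axioms.intro)
      (auto simp: mpoly_hom_def carrier add smult)
qed

lemma graded_exact_quot:
  assumes "graded_projections n M \<pi>" "submodule B (mpoly_ring n) M" "\<And>x d. x \<in> B \<Longrightarrow> \<pi> d x \<in> B"
  shows "graded_exact n M \<pi> B (quot M B) (\<lambda>x. B +>\<^bsub>M\<^esub> x)"
proof -
  interpret M: graded_projections n M \<pi> by fact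
  interpret B: graded_projections n "submod M B" \<pi>
    by (rule graded_projections_submod[OF assms])
  interpret f: mpoly_module_hom n M "quot M B" "\<lambda>x. B +>\<^bsub>M\<^esub> x"
    by (rule M.quot_module_hom(1)[OF assms(2)])
  have grade: "grade (quot M B) d = (\<lambda>x. B +>\<^bsub>M\<^esub> x) ` grade M d" for d
    by (simp add: quot_def)
  show ?thesis
  proof unfold_locales
    show "x \<in> carrier (quot M B)" if "x \<in> grade (quot M B) d" for x d
      using that M.grade_carrier by (auto simp: grade M.quot_module_hom(3)[OF assms(2)])
    show "monom t \<odot>\<^bsub>quot M B\<^esub> x \<in> grade (quot M B) (d + int (monom_degree t))"
      if "Poly_Mapping.keys t \<subseteq> {..<n}" "x \<in> grade (quot M B) d" for t x d
      using that M.grade_carrier M.grade_monom by (auto simp: grade simp flip: f.f_monom)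
    show "B = {x \<in> carrier M. B +>\<^bsub>M\<^esub> x = \<zero>\<^bsub>quot M B\<^esub>}"
      using M.quot_module_hom(2)[OF assms(2)] M.submoduleE(1)[OF assms(2)] by (auto simp: quot_def)
  qed (auto simp: grade M.quot_module_hom(3)[OF assms(2)] assms(3))
qed

lemma graded_exact_image:
  assumes M: "graded_mpoly_module n M" and N: "graded_mpoly_module n N" and f: "f \<in> graded_hom n M N"
  shows "graded_exact n M (grade_proj M) {x \<in> carrier M. f x = \<zero>\<^bsub>N\<^esub>} (submod N (f ` carrier M)) f"
proof -
  interpret GM: graded_mpoly_module n M by fact
  interpret GN: graded_mpoly_module n N by fact
  interpret M: graded_projections n M "grade_proj M"
    by (rule GM.graded_projections)
  interpret N: graded_projections n N "grade_proj N"
    by (rule GN.graded_projections)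
  interpret f: mpoly_module_hom n M N f
    using f by unfold_locales (auto simp: mpoly_hom_def graded_hom_def)
  note proj = grade_proj_hom[OF M N f]
  interpret Q: graded_projections n "submod N (f ` carrier M)" "grade_proj N"
    by (intro graded_projections_submod N.graded_projections_axioms f.image_submodule)
      (auto simp: proj M.proj_closed)
  interpret A: graded_projections n "submod M {x \<in> carrier M. f x = \<zero>\<^bsub>N\<^esub>}" "grade_proj M"
    by (intro graded_projections_submod M.graded_projections_axioms f.kernel_submodule)
      (auto simp: M.proj_closed N.proj_id GN.grade_zero simp flip: proj)
  show ?thesis
  proof unfold_locales
    show "f \<in> mpoly_hom n M (submod N (f ` carrier M))"
      using f.hom by (auto simp: mpoly_hom_def)
    show "f ` grade M d = grade (submod N (f ` carrier M)) d" for d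
    proof
      show "f ` grade M d \<subseteq> grade (submod N (f ` carrier M)) d"
        using f M.grade_carrier by (auto simp: graded_hom_def)
      show "grade (submod N (f ` carrier M)) d \<subseteq> f ` grade M d"
      proof
        fix y assume "y \<in> grade (submod N (f ` carrier M)) d"
        then obtain x where x: "x \<in> carrier M" "y = f x" "y \<in> grade N d"
          by auto
        \<comment> \<open>A homogeneous element of the image has a homogeneous preimage, namely the
          component of any preimage in the same degree.\<close>
        then have "y = f (grade_proj M d x)"
          using proj[of x d] N.proj_id by simp
        then show "y \<in> f ` grade M d"
          using M.proj_grade[OF x(1)] by blast
      qed
    qed
  qed (auto simp: M.proj_closed N.proj_id GN.grade_zero simp flip: proj)
qed

lemma (in mpoly_module_grading) lc_vanish_zero_module:
  assumes "carrier M \<subseteq> {\<zero>}"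
  shows "lc_vanish n M p d"
  unfolding lc_vanish_def
proof clarify
  fix N x assume x: "\<forall>S\<in>cech_index n p. x S \<in> grade M (d + int N * p)"
  have "monom (var_power T 0) \<odot> x T = koszul_diff M (N + 0) (\<lambda>_. \<zero>) T" if T: "T \<in> cech_index n p" for T
  proof -
    have "monom (var_power T 0) \<odot> x T \<in> carrier M"
      using x T grade_carrier keys_var_power_n[OF T] by (intro monom_smult_closed) auto
    moreover have "koszul_diff M (N + 0) (\<lambda>_. \<zero>) T \<in> carrier M"
      by (intro koszul_diff_closed[OF T]) auto
    ultimately show ?thesis
      using assms by (metis singletonD subsetD)
  qed
  then show "\<exists>K y. (\<forall>S\<in>cech_index n (p - 1). y S \<in> carrier M) \<and>
        (\<forall>T\<in>cech_index n p. monom (var_power T K) \<odot> x T = koszul_diff M (N + K) y T)"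
    by (intro exI[of _ 0] exI[of _ "\<lambda>_. \<zero>"]) auto
qed


section \<open>Complexes\<close>

locale graded_complex =
  fixes n :: nat and C :: "int \<Rightarrow> ('k::field mpoly, 'b) graded_module" and D :: "int \<Rightarrow> 'b \<Rightarrow> 'b"
  assumes graded: "graded_mpoly_module n (C i)"
    and diff_hom: "D i \<in> graded_hom n (C i) (C (i - 1))"
    and diff_diff: "x \<in> carrier (C (i + 1)) \<Longrightarrow> D i (D (i + 1) x) = \<zero>\<^bsub>C (i - 1)\<^esub>"
begin

abbreviation "Z \<equiv> cycles C D"
abbreviation "B \<equiv> boundaries C D"
abbreviation "H \<equiv> homology C D"

lemma exact_cycles: "graded_exact n (C i) (grade_proj (C i)) (carrier (Z i)) (B (i - 1)) (D i)"
  using graded_exact_image[OF graded graded diff_hom[of i]] by (simp add: cycles_def boundaries_def)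

lemma exact_boundaries:
  "graded_exact n (Z i) (grade_proj (C i)) (carrier (B i)) (H i) (\<lambda>x. carrier (B i) +>\<^bsub>Z i\<^esub> x)"
  unfolding homology_def
proof (rule graded_exact_quot)
  interpret E: graded_exact n "C i" "grade_proj (C i)" "carrier (Z i)" "B (i - 1)" "D i"
    by (rule exact_cycles)
  interpret E': graded_exact n "C (i + 1)" "grade_proj (C (i + 1))" "carrier (Z (i + 1))" "B i" "D (i + 1)"
    using exact_cycles[of "i + 1"] by simp
  show Z: "graded_projections n (Z i) (grade_proj (C i))"
    using graded_projections_submod[OF E.M.graded_projections_axioms _ E.proj_kernel]
      E.f.kernel_submodule
    by (simp add: cycles_def boundaries_def)
  then interpret Z: graded_projections n "Z i" "grade_proj (C i)" .
  have f: "mpoly_module_hom n (C (i + 1)) (Z i) (D (i + 1))"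
  proof unfold_locales
    have "D (i + 1) \<in> graded_hom n (C (i + 1)) (C i)"
      using diff_hom[of "i + 1"] by simp
    \<comment> \<open>Here the composite of two differentials being zero enters: the boundaries are
      the image of a map into the cycles, hence a submodule of \<open>Z i\<close>.\<close>
    then show "D (i + 1) \<in> mpoly_hom n (C (i + 1)) (Z i)"
      using diff_diff[of _ i] by (simp add: mpoly_hom_def graded_hom_def cycles_def Pi_def)
  qed
  show "submodule (carrier (B i)) (mpoly_ring n) (Z i)"
    using mpoly_module_hom.image_submodule[OF f] by (simp add: boundaries_def)
  fix x d assume "x \<in> carrier (B i)"
  then obtain y where "y \<in> carrier (C (i + 1))" "x = D (i + 1) y"
    by (auto simp: boundaries_def)
  then show "grade_proj (C i) d x \<in> carrier (B i)"
    using grade_proj_hom[OF graded graded diff_hom[of "i + 1"], of y d] E'.M.proj_closed[of y d]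
    by (auto simp: boundaries_def)
qed

lemma boundaries_subset: "carrier (B i) \<subseteq> carrier (Z i)"
proof -
  interpret E: graded_exact n "Z i" "grade_proj (C i)" "carrier (B i)" "H i" "\<lambda>x. carrier (B i) +>\<^bsub>Z i\<^esub> x"
    by (rule exact_boundaries)
  show ?thesis
    using E.N_carrier by blast
qed

lemma submod_cycles: "submod (C i) (carrier (Z i)) = Z i"
  by (simp add: cycles_def)

text \<open>\<open>boundaries\<close> cuts the submodule out of \<open>C i\<close>, the exact
  sequence out of \<open>Z i\<close>. As the boundaries are cycles, both give the same record,
  including the grading.\<close>

lemma submod_boundaries: "submod (Z i) (carrier (B i)) = B i"
proof -
  have "carrier (B i) \<subseteq> carrier (Z i)"
    by (rule boundaries_subset)
  then have "grade (C i) d \<inter> carrier (Z i) \<inter> carrier (B i) = grade (C i) d \<inter> carrier (B i)" for d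
    by blast
  then show ?thesis
    by (simp add: cycles_def boundaries_def submod_def)
qed

lemma grading: "mpoly_module_grading n (C i)" "mpoly_module_grading n (Z i)"
  "mpoly_module_grading n (B i)" "mpoly_module_grading n (H i)"
  using graded_exact.axioms(1,2)[OF exact_cycles[of i]] graded_exact.axioms(2,3)[OF exact_boundaries[of i]]
  by (simp_all add: submod_cycles submod_boundaries graded_projections_def)

text \<open>The instances of the three chases for the two families of sequences. Deducing a quotient
  uses the submodule one cohomological index higher; deducing a submodule uses the quotient one
  index lower.\<close>

lemmas cycles_from_homology =
    graded_exact.lc_vanish_middle[OF exact_boundaries, unfolded submod_boundaries]
  and homology_from_cycles =
    graded_exact.lc_vanish_quotient[OF exact_boundaries, unfolded submod_boundaries]
  and boundaries_from_homology =
    graded_exact.lc_vanish_sub[OF exact_boundaries, unfolded submod_boundaries]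
  and boundaries_from_cycles =
    graded_exact.lc_vanish_quotient[OF exact_cycles, unfolded submod_cycles]
  and cycles_from_boundaries =
    graded_exact.lc_vanish_sub[OF exact_cycles, unfolded submod_cycles]

lemma cycles_zero: "carrier (C i) = {\<zero>\<^bsub>C i\<^esub>} \<Longrightarrow> lc_vanish n (Z i) p d"
  by (rule mpoly_module_grading.lc_vanish_zero_module[OF grading(2)]) (auto simp: cycles_def)

lemma boundaries_zero': "carrier (C i) = {\<zero>\<^bsub>C i\<^esub>} \<Longrightarrow> lc_vanish n (B i) p d"
  using boundaries_subset[of i]
  by (intro mpoly_module_grading.lc_vanish_zero_module[OF grading(3)]) (auto simp: cycles_def boundaries_def)

text \<open>Here \<open>B i\<close> vanishes because its source does, as at the left end of the
  complex; in \<open>boundaries_zero'\<close> it vanishes because its ambient module does, as at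
  index \<open>-1\<close>.\<close>

lemma boundaries_zero:
  assumes "carrier (C (i + 1)) = {\<zero>\<^bsub>C (i + 1)\<^esub>}"
  shows "lc_vanish n (B i) p d"
proof (rule mpoly_module_grading.lc_vanish_zero_module[OF grading(3)])
  interpret E: graded_exact n "C (i + 1)" "grade_proj (C (i + 1))" "carrier (Z (i + 1))" "B i" "D (i + 1)"
    using exact_cycles[of "i + 1"] by simp
  show "carrier (B i) \<subseteq> {\<zero>\<^bsub>B i\<^esub>}"
    using E.f_carrier E.f.f_zero assms by auto
qed

end

theorem lemma3p1:
  fixes n :: nat and X :: "nat set" and m :: int
    and C :: "int \<Rightarrow> ('k::field mpoly, 'b) graded_module"
    and D :: "int \<Rightarrow> 'b \<Rightarrow> 'b"
  assumes "fg_complex n n C D"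
  shows
    "((\<forall>i>0. regular_wrt n (shift X i) (m + i) (C i)) \<and>
      (\<forall>i>0. regular_wrt n (shift X (i + 1)) (m + i + 1) (homology C D i))
      \<longrightarrow>
        (\<forall>i\<ge>0. regular_wrt n (shift X (i + 1)) (m + i + 1) (boundaries C D i)) \<and>
        (regular_wrt n X m (C 0) \<longrightarrow> regular_wrt n X m (homology C D 0)))
     \<and>
     ((\<forall>i\<ge>0. regular_wrt n (shift X (- i)) (m - i) (C (int n - i))) \<and>
      (\<forall>i>0. regular_wrt n (shift X (- i - 1)) (m - i - 1) (homology C D (int n - i)))
      \<longrightarrow>
        (\<forall>i\<ge>0. regular_wrt n (shift X (- i)) (m - i) (cycles C D (int n - i))) \<and>
        regular_wrt n X m (homology C D (int n)))"
proof -
  interpret graded_complex n C D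
    using assms by (intro graded_complex.intro) (auto simp: fg_complex_def)
  have zero: "carrier (C i) = {\<zero>\<^bsub>C i\<^esub>}" if "i < 0 \<or> i > int n" for i
    using assms that by (auto simp: fg_complex_def)
  have shift: "shift X 0 = X"
    by (auto simp: shift_def)
  \<comment> \<open>In this form neither the set of \<open>j\<close> nor the range of
    \<open>d\<close> depends on \<open>a\<close>.\<close>
  have reg: "regular_wrt n (shift X a) b M \<longleftrightarrow> (\<forall>j\<in>X. \<forall>d>m - int j. lc_vanish n M (int j + a) d)"
    if "mpoly_module_grading n M" "b = m + a" for M :: "('k mpoly, 'c) graded_module" and a b
    using mpoly_module_grading.regular_wrt_shift_iff[OF that(1), of X a m] that(2) by simp
  have reg0: "regular_wrt n X m M \<longleftrightarrow> (\<forall>j\<in>X. \<forall>d>m - int j. lc_vanish n M (int j) d)"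
    if "mpoly_module_grading n M" for M :: "('k mpoly, 'c) graded_module"
    using reg[OF that, of m 0] by (simp add: shift)
  show ?thesis
  proof (intro conjI impI)
    assume "(\<forall>i>0. regular_wrt n (shift X i) (m + i) (C i)) \<and>
      (\<forall>i>0. regular_wrt n (shift X (i + 1)) (m + i + 1) (H i))"
    then have RC: "\<forall>i>0. regular_wrt n (shift X i) (m + i) (C i)"
      and RH: "\<forall>i>0. regular_wrt n (shift X (i + 1)) (m + i + 1) (H i)"
      by blast+
    have C: "lc_vanish n (C i) (int j + i) d" if "i > 0" "j \<in> X" "d > m - int j" for i j d
      using RC that reg[OF grading(1), of "m + i" i i] by simp
    have H: "lc_vanish n (H i) (int j + i + 1) d" if "i > 0" "j \<in> X" "d > m - int j" for i j d
      using RH that reg[OF grading(4), of "m + i + 1" "i + 1" i] by (simp add: add.assoc)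
    \<comment> \<open>Descending induction on \<open>i\<close>, with \<open>k\<close> bounding the
      distance to the left end. For \<open>k = 0\<close> the source \<open>C (i + 1)\<close> lies
      beyond position \<open>n\<close>.\<close>
    have B: "lc_vanish n (B i) (int j + i + 1) d"
      if "j \<in> X" "d > m - int j" "i \<ge> 0" "i \<ge> int n - int k" for i j d k
      using that(3,4)
    proof (induction k arbitrary: i)
      case 0
      then show ?case
        by (intro boundaries_zero zero) auto
    next
      case (Suc k)
      \<comment> \<open>One step uses both sequences at position \<open>i + 1\<close>: boundaries
        and homology give the cycles at the same cohomological index, and these together with
        \<open>C (i + 1)\<close> give \<open>B i\<close> one index lower.\<close>
      have "lc_vanish n (B (i + 1)) (int j + (i + 1) + 1) d"
        using Suc.prems by (intro Suc.IH) auto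
      then have "lc_vanish n (Z (i + 1)) (int j + (i + 1) + 1) d"
        using Suc.prems that(1,2) by (intro cycles_from_homology H) auto
      then have "lc_vanish n (B (i + 1 - 1)) (int j + (i + 1)) d"
        using Suc.prems that(1,2) by (intro boundaries_from_cycles C) auto
      then show ?case
        by (simp add: add.assoc)
    qed
    have B: "lc_vanish n (B i) (int j + i + 1) d" if "j \<in> X" "d > m - int j" "i \<ge> 0" for i j d
      by (rule B[of _ _ _ n]) (use that in auto)
    then show "\<forall>i\<ge>0. regular_wrt n (shift X (i + 1)) (m + i + 1) (B i)"
      by (simp add: reg[OF grading(3)] add.assoc)
    show "regular_wrt n X m (H 0)" if "regular_wrt n X m (C 0)"
      unfolding reg0[OF grading(4)]
    proof (intro ballI allI impI)
      fix j d assume j: "j \<in> X" "m - int j < d"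
      \<comment> \<open>There is nothing to the right of \<open>C 0\<close>, so the boundaries at
        \<open>-1\<close> are zero and the cycles at \<open>0\<close> inherit the vanishing from
        \<open>C 0\<close>.\<close>
      have "lc_vanish n (Z 0) (int j) d"
      proof (rule cycles_from_boundaries)
        show "lc_vanish n (B (0 - 1)) (int j - 1) d"
          by (intro boundaries_zero' zero) simp
        show "lc_vanish n (C 0) (int j) d"
          using that j by (simp add: reg0[OF grading(1)])
      qed
      then show "lc_vanish n (H 0) (int j) d"
        using B[OF j, of 0] by (intro homology_from_cycles) auto
    qed
  next
    assume "(\<forall>i\<ge>0. regular_wrt n (shift X (- i)) (m - i) (C (int n - i))) \<and>
      (\<forall>i>0. regular_wrt n (shift X (- i - 1)) (m - i - 1) (H (int n - i)))"
    then have RC: "\<forall>i\<ge>0. regular_wrt n (shift X (- i)) (m - i) (C (int n - i))"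
      and RH: "\<forall>i>0. regular_wrt n (shift X (- i - 1)) (m - i - 1) (H (int n - i))"
      by blast+
    have C: "lc_vanish n (C (int n - i)) (int j - i) d" if "i \<ge> 0" "j \<in> X" "d > m - int j" for i j d
      using RC that reg[OF grading(1), of "m - i" "- i" "int n - i"] by simp
    have H: "lc_vanish n (H (int n - i)) (int j - i - 1) d" if "i > 0" "j \<in> X" "d > m - int j" for i j d
      using RH that reg[OF grading(4), of "m - i - 1" "- i - 1" "int n - i"]
      by (simp add: add_diff_eq)
    \<comment> \<open>Induction from the right end. The inequality is strict because the base case
      must have \<open>i > n\<close>, where \<open>C (n - i)\<close> is zero; reaching
      \<open>i = 0\<close> therefore takes \<open>k = Suc n\<close>.\<close>
    have Z: "lc_vanish n (Z (int n - i)) (int j - i) d"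
      if "j \<in> X" "d > m - int j" "i \<ge> 0" "i > int n - int k" for i j d k
      using that(3,4)
    proof (induction k arbitrary: i)
      case 0
      then show ?case
        by (intro cycles_zero zero) auto
    next
      case (Suc k)
      \<comment> \<open>At position \<open>n - i - 1\<close>, the cycles and the homology one index
        lower give the boundaries. These, with \<open>C (n - i)\<close> one index higher, give the
        cycles at position \<open>n - i\<close>.\<close>
      have "lc_vanish n (Z (int n - (i + 1))) (int j - (i + 1)) d"
        using Suc.prems by (intro Suc.IH) auto
      then have "lc_vanish n (B (int n - (i + 1))) (int j - (i + 1)) d"
        using Suc.prems that(1,2) by (intro boundaries_from_homology H) auto
      then have "lc_vanish n (B (int n - i - 1)) (int j - i - 1) d"
        by (simp add: diff_diff_eq)
      then show ?case
        using Suc.prems that(1,2) by (intro cycles_from_boundaries C) auto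
    qed
    have Z: "lc_vanish n (Z (int n - i)) (int j - i) d" if "j \<in> X" "d > m - int j" "i \<ge> 0" for i j d
      by (rule Z[of _ _ _ "Suc n"]) (use that in auto)
    then show "\<forall>i\<ge>0. regular_wrt n (shift X (- i)) (m - i) (Z (int n - i))"
      by (simp add: reg[OF grading(2)])
    show "regular_wrt n X m (H (int n))"
      unfolding reg0[OF grading(4)]
    proof (intro ballI allI impI)
      fix j d assume "j \<in> X" "m - int j < d"
      then have "lc_vanish n (Z (int n)) (int j) d"
        using Z[of j d 0] by simp
      then show "lc_vanish n (H (int n)) (int j) d"
        \<comment> \<open>At the left end the boundaries vanish because \<open>C (n + 1)\<close> is
          zero, so the homology inherits the vanishing from the cycles.\<close>
        by (intro homology_from_cycles boundaries_zero zero) auto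
    qed
  qed
qed

end
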